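(* Let $\mathbb G$ be a homogeneous group of dimension $q$, let $1\le n\le q$, and let $d$ be an $n$-vertically symmetric homogeneous distance on $\mathbb G$. Then the spherical factor $\beta_d(N)$ is the same for every $n$-dimensional vertical subgroup $N\subset\mathbb G$.
   Context: A homogeneous group is a finite dimensional real vector space $\mathbb G=H^1\oplus\cdots\oplus H^\iota$, $H^\iota\neq\{0\}$, with a nilpotent Lie bracket satisfying $[H^i,H^j]\subset H^{i+j}$ ($H^k=\{0\}$ for $k>\iota$), with group law given by the Baker-Campbell-Hausdorff formula $xy=x+y+\frac12[x,y]+\cdots$ (so the identity is $0$ and $x^{-1}=-x$), and with the linear dilations $\delta_r$, $r>0$, $\delta_r x=r^ix$ for $x\in H^i$. Put $h_j=\dim H^j$. A scalar product on $\mathbb G$ making the $H^j$ mutually orthogonal is fixed, with norm $|\cdot|$. A homogeneous distance $d$ is a left invariant distance with $d(\delta_rx,\delta_ry)=r\,d(x,y)$; $\mathbb B(x,r)$ denotes the closed $d$-ball. A vertical subgroup is a Lie subgroup of the form $N_\ell\oplus H^{\ell+1}\oplus\cdots\oplus H^\iota$, with $\ell\in\{1,\dots,\iota\}$ and $N_\ell\subset H^\ell$ a linear subspace. For an $n$-dimensional linear subspace $S\subset\mathbb G$, the spherical factor is $\beta_d(S)=\max_{d(u,0)\le1}\mathcal H^n_{|\cdot|}(\mathbb B(u,1)\cap S)$, where $\mathcal H^n_{|\cdot|}$ is the $n$-dimensional Hausdorff measure of $|\cdot|$, normalized to agree with Lebesgue measure on $n$-dimensional affine subspaces. $n$-vertically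 symmetric distance. Let $\ell=\ell_n\in\{1,\dots,\iota\}$ be the unique integer with $\sum_{j=\ell+1}^\iota h_j<n\le\sum_{j=\ell}^\iota h_j$, and $r_n=n-\sum_{j=\ell+1}^\iota h_j$. If $r_n=h_\ell$, every homogeneous distance is $n$-vertically symmetric. If $r_n<h_\ell$, put $U=H^1\oplus\cdots\oplus H^{\ell-1}$, $V=H^1\oplus\cdots\oplus H^\ell$, and let $P_U,P_V,P_{H^\ell}$ be the orthogonal projections of $\mathbb G$ onto $U,V,H^\ell$; $d$ is $n$-vertically symmetric if there is a family $\mathcal F_\ell\subset O(H^\ell)$ of linear isometries such that for any two $r_n$-dimensional subspaces $S_1,S_2\subset H^\ell$ there is $J\in\mathcal F_\ell$ with $J(S_1)=S_2$, and such that: (1) $P_V(\mathbb B(0,1))=\mathbb B(0,1)\cap V=\{v\in V:\psi(P_U(v),|P_{H^\ell}(v)|)\le r_0\}$ for some $r_0>0$ and some $\psi:U\times[0,+\infty)\to[0,+\infty)$ monotone nondecreasing in the second variable (for $\ell=1$, $U=\{0\}$ and $\psi$ is a nondecreasing function on $[0,+\infty)$); (2) $T(\mathbb B(0,1))=\mathbb B(0,1)$ for every linear isometry $T\in O(\mathbb G)$ with $T|_{H^j}=\mathrm{Id}$ for $j\ne\ell$ and $T|_{H^\ell}\in\mathcal F_\ell$. *)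

theory Defs
  imports "HOL-Analysis.Analysis"
begin

section \<open>Homogeneous groups\<close>

text \<open>
  The underlying vector space is a type of class \<open>euclidean_space\<close>, so that the scalar product and
  the norm \<open>|\<cdot>|\<close> are those of the type, and \<open>q\<close> is \<open>DIM('a)\<close>. The layers are \<open>H 1, \<dots>, H s\<close> (\<open>s\<close> is
  the step), and \<open>H 0\<close> plays no role. Nilpotency of the bracket is not assumed separately, since it
  follows from the grading; see \<open>nested_bracket_eq_0\<close> below.
\<close>

locale homogeneous_group =
  fixes br :: "'a::euclidean_space \<Rightarrow> 'a \<Rightarrow> 'a"
    and s :: nat
    and H :: "nat \<Rightarrow> 'a set"
  assumes step_pos: "1 \<le> s"
    and subspace_layer: "\<And>j. 1 \<le> j \<Longrightarrow> subspace (H j)"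
    and top_layer_nontrivial: "H s \<noteq> {0}"
    and layer_beyond: "\<And>k. s < k \<Longrightarrow> H k = {0}"
    and direct_sum: "\<And>x. \<exists>!f. f \<in> (\<Pi>\<^sub>E j\<in>{1..s}. H j) \<and> x = (\<Sum>j=1..s. f j)"
    and bilinear_bracket: "bilinear br"
    and bracket_self: "\<And>x. br x x = 0"
    and jacobi: "\<And>x y z. br x (br y z) + br y (br z x) + br z (br x y) = 0"
    and graded: "\<And>i j x y. \<lbrakk>1 \<le> i; 1 \<le> j; x \<in> H i; y \<in> H j\<rbrakk> \<Longrightarrow> br x y \<in> H (i + j)"

definition orthogonal_layers :: "nat \<Rightarrow> (nat \<Rightarrow> 'a::euclidean_space set) \<Rightarrow> bool" where
  "orthogonal_layers s H \<longleftrightarrow>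
     (\<forall>i\<in>{1..s}. \<forall>j\<in>{1..s}. i \<noteq> j \<longrightarrow> (\<forall>x\<in>H i. \<forall>y\<in>H j. orthogonal x y))"

text \<open>\<open>layers H j k\<close> is \<open>H j \<oplus> \<dots> \<oplus> H k\<close>, which is \<open>{0}\<close> if \<open>k < j\<close>.\<close>

definition layers :: "(nat \<Rightarrow> 'a::euclidean_space set) \<Rightarrow> nat \<Rightarrow> nat \<Rightarrow> 'a set" where
  "layers H j k = span (\<Union>i\<in>{j..k}. H i)"

text \<open>Right-nested brackets \<open>[x\<^sub>1, [x\<^sub>2, \<dots> [x\<^sub>m\<^sub>-\<^sub>1, x\<^sub>m]]]\<close>.\<close>

fun nested_bracket :: "('a::zero \<Rightarrow> 'a \<Rightarrow> 'a) \<Rightarrow> 'a list \<Rightarrow> 'a" where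
  "nested_bracket br [] = 0"
| "nested_bracket br [x] = x"
| "nested_bracket br (x # y # zs) = br x (nested_bracket br (y # zs))"

text \<open>
  The Baker-Campbell-Hausdorff product in Dynkin's form
  \[ xy = \sum_{k \ge 1} \frac{(-1)^{k-1}}{k} \sum
      \frac{[x^{a_1} y^{b_1} \cdots x^{a_k} y^{b_k}]}{(\sum_i (a_i + b_i)) \prod_i a_i! \, b_i!}, \]
  where the inner sum is over \<open>(a\<^sub>1, b\<^sub>1), \<dots>, (a\<^sub>k, b\<^sub>k)\<close> with all \<open>a\<^sub>i + b\<^sub>i > 0\<close> and the bracket is
  right-nested. Brackets of more than \<open>s\<close> elements vanish, so the series is cut off at total degree
  \<open>s\<close>, which makes it a finite sum.
\<close>

definition dynkin_degree :: "(nat \<times> nat) list \<Rightarrow> nat" where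
  "dynkin_degree p = (\<Sum>(a, b)\<leftarrow>p. a + b)"

definition dynkin_exponents :: "nat \<Rightarrow> nat \<Rightarrow> (nat \<times> nat) list set" where
  "dynkin_exponents s k =
     {p. length p = k \<and> (\<forall>(a, b)\<in>set p. 0 < a + b) \<and> dynkin_degree p \<le> s}"

definition dynkin_word :: "'a \<Rightarrow> 'a \<Rightarrow> (nat \<times> nat) list \<Rightarrow> 'a list" where
  "dynkin_word x y p = concat (map (\<lambda>(a, b). replicate a x @ replicate b y) p)"

definition bch :: "('a::real_vector \<Rightarrow> 'a \<Rightarrow> 'a) \<Rightarrow> nat \<Rightarrow> 'a \<Rightarrow> 'a \<Rightarrow> 'a" where
  "bch br s x y =
     (\<Sum>k=1..s. ((-1) ^ (k - 1) / real k) *\<^sub>R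
        (\<Sum>p\<in>dynkin_exponents s k.
           (1 / (real (dynkin_degree p) * (\<Prod>(a, b)\<leftarrow>p. fact a * fact b))) *\<^sub>R
             nested_bracket br (dynkin_word x y p)))"

definition dilation :: "nat \<Rightarrow> (nat \<Rightarrow> 'a::euclidean_space set) \<Rightarrow> real \<Rightarrow> 'a \<Rightarrow> 'a" where
  "dilation s H r = (THE T. linear T \<and> (\<forall>i\<in>{1..s}. \<forall>x\<in>H i. T x = r ^ i *\<^sub>R x))"

definition homogeneous_distance ::
  "('a::euclidean_space \<Rightarrow> 'a \<Rightarrow> 'a) \<Rightarrow> nat \<Rightarrow> (nat \<Rightarrow> 'a set) \<Rightarrow> ('a \<Rightarrow> 'a \<Rightarrow> real) \<Rightarrow> bool" where
  "homogeneous_distance br s H d \<longleftrightarrow>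
     Metric_space UNIV d \<and>
     (\<forall>z x y. d (bch br s z x) (bch br s z y) = d x y) \<and>
     (\<forall>r>0. \<forall>x y. d (dilation s H r x) (dilation s H r y) = r * d x y)"

abbreviation closed_ball :: "('a \<Rightarrow> 'a \<Rightarrow> real) \<Rightarrow> 'a \<Rightarrow> real \<Rightarrow> 'a set" where
  "closed_ball d \<equiv> Metric_space.mcball UNIV d"

text \<open>
  A linear subspace that is a subgroup is closed, hence a Lie subgroup. The inverse of \<open>x\<close> is \<open>- x\<close>.
\<close>

definition vertical_subgroup ::
  "('a::euclidean_space \<Rightarrow> 'a \<Rightarrow> 'a) \<Rightarrow> nat \<Rightarrow> (nat \<Rightarrow> 'a set) \<Rightarrow> 'a set \<Rightarrow> bool" where
  "vertical_subgroup br s H N \<longleftrightarrow>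
     (\<exists>l\<in>{1..s}. \<exists>N\<^sub>l. subspace N\<^sub>l \<and> N\<^sub>l \<subseteq> H l \<and> N = {x + y | x y. x \<in> N\<^sub>l \<and> y \<in> layers H (l + 1) s}) \<and>
     0 \<in> N \<and> (\<forall>x\<in>N. \<forall>y\<in>N. bch br s x y \<in> N) \<and> (\<forall>x\<in>N. - x \<in> N)"


section \<open>Hausdorff measure and spherical factor\<close>

text \<open>
  The weight \<open>unit_ball_vol n * (diameter E / 2) ^ n\<close> is the volume of an \<open>n\<close>-dimensional ball with
  the diameter of \<open>E\<close>; by the isodiametric inequality this is the normalization for which the
  measure agrees with Lebesgue measure on \<open>n\<close>-dimensional affine subspaces. Covering sets are
  required to be bounded because \<open>diameter\<close> is unspecified on unbounded sets.
\<close>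

definition hausdorff_weight :: "nat \<Rightarrow> 'a::metric_space set \<Rightarrow> ennreal" where
  "hausdorff_weight n E =
     (if E = {} then 0 else ennreal (unit_ball_vol (real n) * (diameter E / 2) ^ n))"

definition hausdorff_premeasure :: "nat \<Rightarrow> real \<Rightarrow> 'a::metric_space set \<Rightarrow> ennreal" where
  "hausdorff_premeasure n \<delta> A =
     (INF E\<in>{E :: nat \<Rightarrow> 'a set. A \<subseteq> (\<Union>i. E i) \<and> (\<forall>i. bounded (E i) \<and> diameter (E i) \<le> \<delta>)}.
        \<Sum>i. hausdorff_weight n (E i))"

definition hausdorff_measure :: "nat \<Rightarrow> 'a::metric_space set \<Rightarrow> ennreal" where
  "hausdorff_measure n A = (SUP \<delta>\<in>{0<..}. hausdorff_premeasure n \<delta> A)"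

text \<open>The maximum over \<open>u\<close> is expressed as a supremum in \<open>[0, \<infinity>]\<close>.\<close>

definition spherical_factor ::
  "('a::euclidean_space \<Rightarrow> 'a \<Rightarrow> real) \<Rightarrow> nat \<Rightarrow> 'a set \<Rightarrow> ennreal" where
  "spherical_factor d n S = (SUP u\<in>{u. d u 0 \<le> 1}. hausdorff_measure n (closed_ball d u 1 \<inter> S))"


section \<open>Vertically symmetric distances\<close>

definition orthogonal_projection :: "'a::euclidean_space set \<Rightarrow> 'a \<Rightarrow> 'a" where
  "orthogonal_projection W x = (THE p. p \<in> W \<and> (\<forall>w\<in>W. orthogonal (x - p) w))"

text \<open>
  \<open>O(W)\<close> for a subspace \<open>W\<close>; its elements are functions on \<open>W\<close>, represented as extensional functions
  so that they can be compared with restrictions to \<open>W\<close>.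
\<close>

definition linear_isometries :: "'a::euclidean_space set \<Rightarrow> ('a \<Rightarrow> 'a) set" where
  "linear_isometries W =
     {J \<in> W \<rightarrow>\<^sub>E W. J ` W = W \<and>
        (\<forall>x\<in>W. \<forall>y\<in>W. \<forall>a b. J (a *\<^sub>R x + b *\<^sub>R y) = a *\<^sub>R J x + b *\<^sub>R J y) \<and>
        (\<forall>x\<in>W. norm (J x) = norm x)}"

definition vertical_index :: "nat \<Rightarrow> (nat \<Rightarrow> 'a::euclidean_space set) \<Rightarrow> nat \<Rightarrow> nat" where
  "vertical_index s H n =
     (THE l. l \<in> {1..s} \<and> (\<Sum>j=l+1..s. dim (H j)) < n \<and> n \<le> (\<Sum>j=l..s. dim (H j)))"

definition vertical_rest :: "nat \<Rightarrow> (nat \<Rightarrow> 'a::euclidean_space set) \<Rightarrow> nat \<Rightarrow> nat" where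
  "vertical_rest s H n = n - (\<Sum>j=vertical_index s H n + 1..s. dim (H j))"

text \<open>
  In the following definition \<open>F\<close> is the family of isometries of \<open>H l\<close>. For \<open>l = 1\<close> one has \<open>U = {0}\<close>,
  so \<open>\<psi> 0\<close> is then the nondecreasing function of one variable.
\<close>

definition vertically_symmetric ::
  "('a::euclidean_space \<Rightarrow> 'a \<Rightarrow> 'a) \<Rightarrow> nat \<Rightarrow> (nat \<Rightarrow> 'a set) \<Rightarrow> nat \<Rightarrow> ('a \<Rightarrow> 'a \<Rightarrow> real) \<Rightarrow> bool" where
  "vertically_symmetric br s H n d \<longleftrightarrow>
     homogeneous_distance br s H d \<and>
     (let l = vertical_index s H n;
          r = vertical_rest s H n;
          U = layers H 1 (l - 1);
          V = layers H 1 l;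
          B = closed_ball d 0 1
      in r < dim (H l) \<longrightarrow>
         (\<exists>F \<subseteq> linear_isometries (H l).
            (\<forall>S\<^sub>1 S\<^sub>2. subspace S\<^sub>1 \<and> S\<^sub>1 \<subseteq> H l \<and> dim S\<^sub>1 = r \<and> subspace S\<^sub>2 \<and> S\<^sub>2 \<subseteq> H l \<and> dim S\<^sub>2 = r
               \<longrightarrow> (\<exists>J\<in>F. J ` S\<^sub>1 = S\<^sub>2)) \<and>
            (\<exists>r\<^sub>0>0. \<exists>\<psi> :: 'a \<Rightarrow> real \<Rightarrow> real.
               (\<forall>u\<in>U. \<forall>t\<ge>0. 0 \<le> \<psi> u t) \<and>
               (\<forall>u\<in>U. mono_on {0..} (\<psi> u)) \<and>
               orthogonal_projection V ` B = B \<inter> V \<and>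
               B \<inter> V = {v \<in> V. \<psi> (orthogonal_projection U v)
                                   (norm (orthogonal_projection (H l) v)) \<le> r\<^sub>0}) \<and>
            (\<forall>T. orthogonal_transformation T \<and>
                 (\<forall>j\<in>{1..s}. j \<noteq> l \<longrightarrow> (\<forall>x\<in>H j. T x = x)) \<and> restrict T (H l) \<in> F
               \<longrightarrow> T ` B = B)))"


section \<open>Well-definedness\<close>

lemma finite_dynkin_exponents: "finite (dynkin_exponents s k)"
proof -
  have "dynkin_exponents s k \<subseteq> {p. set p \<subseteq> {..s} \<times> {..s} \<and> length p = k}"
  proof
    fix p assume p: "p \<in> dynkin_exponents s k"
    have "a \<le> s \<and> b \<le> s" if "(a, b) \<in> set p" for a b
    proof -
      have "a + b \<in> set (map (\<lambda>(a, b). a + b) p)"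
        using that by force
      from member_le_sum_list[OF this] have "a + b \<le> dynkin_degree p"
        by (simp add: dynkin_degree_def)
      with p show ?thesis by (simp add: dynkin_exponents_def)
    qed
    then show "p \<in> {p. set p \<subseteq> {..s} \<times> {..s} \<and> length p = k}"
      using p by (auto simp: dynkin_exponents_def)
  qed
  then show ?thesis
    by (rule finite_subset) (simp add: finite_lists_length_eq)
qed

lemma ex1_vertical_index:
  fixes H :: "nat \<Rightarrow> 'a::euclidean_space set"
  assumes "1 \<le> n" and "n \<le> (\<Sum>j=1..s. dim (H j))"
  shows "\<exists>!l. l \<in> {1..s} \<and> (\<Sum>j=l+1..s. dim (H j)) < n \<and> n \<le> (\<Sum>j=l..s. dim (H j))"
proof -
  define S where "S l = (\<Sum>j=l..s. dim (H j))" for l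
  have anti: "S k \<le> S l" if "l \<le> k" for k l
    unfolding S_def using that by (intro sum_mono2) auto
  define m where "m = (GREATEST l. n \<le> S l)"
  have bound: "l \<le> s" if "n \<le> S l" for l
    using that assms(1) by (cases "l \<le> s") (auto simp: S_def)
  have m: "n \<le> S m"
    unfolding m_def
  proof (rule GreatestI_nat)
    show "n \<le> S 1" using assms(2) by (simp add: S_def)
  qed (use bound in blast)
  have le_m: "l \<le> m" if "n \<le> S l" for l
    unfolding m_def
  proof (rule Greatest_le_nat)
    show "n \<le> S l" by (fact that)
  qed (use bound in blast)
  have Sm: "S (m + 1) < n"
    using le_m[of "m + 1"] by (cases "n \<le> S (m + 1)") auto
  have m1: "1 \<le> m"
    using assms(2) le_m[of 1] by (simp add: S_def)
  have uniq: "l = m" if "l \<in> {1..s} \<and> S (l + 1) < n \<and> n \<le> S l" for l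
  proof (rule ccontr)
    assume "l \<noteq> m"
    with le_m[of l] that have "l + 1 \<le> m" by simp
    from anti[OF this] that m show False by simp
  qed
  have "m \<in> {1..s} \<and> S (m + 1) < n \<and> n \<le> S m"
    using m bound[OF m] Sm m1 by simp
  then have "\<exists>!l. l \<in> {1..s} \<and> S (l + 1) < n \<and> n \<le> S l"
    using uniq by (rule ex1I)
  then show ?thesis by (simp only: S_def)
qed

lemma span_subset_induct_linear:
  fixes T :: "'a::real_vector \<Rightarrow> 'b::real_vector"
  assumes "linear T" "subspace W" "\<And>x. x \<in> A \<Longrightarrow> T x \<in> W" "x \<in> span A"
  shows "T x \<in> W"
proof -
  have "T ` span A = span (T ` A)"
    using assms(1) by (simp add: linear_span_image)
  also have "\<dots> \<subseteq> W"
    using assms(2,3) by (intro span_minimal) auto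
  finally show ?thesis using assms(4) by blast
qed

context homogeneous_group
begin

lemma span_layers: "layers H 1 s = UNIV"
proof -
  have "x \<in> span (\<Union>i\<in>{1..s}. H i)" for x
  proof -
    obtain f where f: "f \<in> (\<Pi>\<^sub>E j\<in>{1..s}. H j)" "x = (\<Sum>j=1..s. f j)"
      using direct_sum[of x] by blast
    have "f j \<in> span (\<Union>i\<in>{1..s}. H i)" if "j \<in> {1..s}" for j
      using f(1) that by (intro span_base) auto
    then show ?thesis unfolding f(2) by (rule span_sum)
  qed
  then show ?thesis by (auto simp: layers_def)
qed

lemma bracket_layers:
  assumes "y \<in> layers H k s" "1 \<le> k"
  shows "br x y \<in> layers H (k + 1) s"
proof -
  have sub: "subspace (layers H (k + 1) s)" by (simp add: layers_def)
  have lin: "linear (br x)" "linear (\<lambda>x. br x y)" for x y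
    using bilinear_bracket by (auto simp: bilinear_def)
  have base: "br x y \<in> layers H (k + 1) s"
    if "i \<in> {1..s}" "x \<in> H i" "j \<in> {k..s}" "y \<in> H j" for i j x y
  proof (cases "i + j \<le> s")
    case True
    then have "br x y \<in> (\<Union>i\<in>{k+1..s}. H i)"
      using graded[of i j x y] that assms(2) by (intro UN_I[of "i + j"]) auto
    then show ?thesis by (auto simp: layers_def intro: span_base)
  next
    case False
    then have "br x y = 0"
      using graded[of i j x y] layer_beyond[of "i + j"] that assms(2) by auto
    then show ?thesis using sub by (simp add: subspace_0)
  qed
  have "br x y \<in> layers H (k + 1) s" if "y \<in> (\<Union>j\<in>{k..s}. H j)" for x y
  proof (rule span_subset_induct_linear[OF lin(2) sub])
    show "x \<in> span (\<Union>i\<in>{1..s}. H i)"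
      using span_layers by (simp add: layers_def)
  qed (use base that in blast)
  then show ?thesis
    by (rule span_subset_induct_linear[OF lin(1) sub]) (use assms(1) in \<open>auto simp: layers_def\<close>)
qed

lemma nested_bracket_in_layers:
  "xs \<noteq> [] \<Longrightarrow> nested_bracket br xs \<in> layers H (length xs) s"
proof (induction xs rule: list_nonempty_induct)
  case (single x)
  then show ?case using span_layers by simp
next
  case (cons x xs)
  then obtain y zs where xs: "xs = y # zs" by (cases xs) auto
  have "br x (nested_bracket br xs) \<in> layers H (length xs + 1) s"
    using cons xs by (intro bracket_layers) auto
  then show ?case by (simp add: xs)
qed

lemma nested_bracket_eq_0:
  assumes "s < length xs"
  shows "nested_bracket br xs = 0"
  using nested_bracket_in_layers[of xs] assms by (cases xs) (auto simp: layers_def)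

lemma ex1_dilation: "\<exists>!T. linear T \<and> (\<forall>i\<in>{1..s}. \<forall>x\<in>H i. T x = r ^ i *\<^sub>R x)"
proof -
  define c where "c x = (THE f. f \<in> (\<Pi>\<^sub>E j\<in>{1..s}. H j) \<and> x = (\<Sum>j=1..s. f j))" for x
  have c: "c x \<in> (\<Pi>\<^sub>E j\<in>{1..s}. H j)" "x = (\<Sum>j=1..s. c x j)" for x
    using theI'[OF direct_sum[of x]] by (auto simp: c_def)
  have c_eq: "c x = restrict f {1..s}"
    if "\<And>j. j \<in> {1..s} \<Longrightarrow> f j \<in> H j" "x = (\<Sum>j=1..s. f j)" for x f
  proof -
    have "restrict f {1..s} \<in> (\<Pi>\<^sub>E j\<in>{1..s}. H j) \<and> x = (\<Sum>j=1..s. restrict f {1..s} j)"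
      using that by auto
    with c[of x] direct_sum[of x] show ?thesis by blast
  qed
  have cH: "c x j \<in> H j" if "j \<in> {1..s}" for x j
    using c(1)[of x] that by auto
  define T where "T x = (\<Sum>j=1..s. r ^ j *\<^sub>R c x j)" for x
  have add: "c (x + y) = restrict (\<lambda>j. c x j + c y j) {1..s}" for x y
  proof (rule c_eq)
    show "x + y = (\<Sum>j=1..s. c x j + c y j)"
      using c(2)[of x] c(2)[of y] by (simp add: sum.distrib)
  qed (use cH subspace_layer in \<open>auto intro: subspace_add\<close>)
  have scale: "c (a *\<^sub>R x) = restrict (\<lambda>j. a *\<^sub>R c x j) {1..s}" for a x
  proof (rule c_eq)
    show "a *\<^sub>R x = (\<Sum>j=1..s. a *\<^sub>R c x j)"
      using c(2)[of x] by (metis scaleR_sum_right)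
  qed (use cH subspace_layer in \<open>auto intro: subspace_scale\<close>)
  have lin: "linear T"
    by (rule linearI)
      (simp_all add: T_def add scale sum.distrib scaleR_right_distrib scaleR_sum_right mult.commute)
  have T: "T x = r ^ i *\<^sub>R x" if "i \<in> {1..s}" "x \<in> H i" for i x
  proof -
    have "c x = restrict (\<lambda>j. if j = i then x else 0) {1..s}"
      using that subspace_layer by (intro c_eq) (auto intro: subspace_0)
    then have "T x = (\<Sum>j=1..s. if j = i then r ^ i *\<^sub>R x else 0)"
      unfolding T_def by (intro sum.cong) auto
    then show ?thesis using that by simp
  qed
  have uniq: "T' = T''"
    if "linear T'" "\<forall>i\<in>{1..s}. \<forall>x\<in>H i. T' x = r ^ i *\<^sub>R x"
       "linear T''" "\<forall>i\<in>{1..s}. \<forall>x\<in>H i. T'' x = r ^ i *\<^sub>R x" for T' T'' :: "'a \<Rightarrow> 'a"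
  proof
    fix x
    have x: "x \<in> span (\<Union>i\<in>{1..s}. H i)"
      using span_layers by (simp add: layers_def)
    show "T' x = T'' x"
      by (rule linear_eq_on[OF that(1,3) x]) (metis UN_E that(2,4))
  qed
  show ?thesis
    using lin T uniq by (intro ex1I[where a = T]) blast+
qed

end

end

theory Submission
  imports Defs
begin

text \<open>
  Write \<open>B(u)\<close> for the closed unit ball around \<open>u\<close>, and \<open>B\<close> for \<open>B(0)\<close>. By left invariance \<open>x \<in> B(u)\<close>
  if and only if \<open>(- u) x \<in> B\<close>, where \<open>(- u) x = - u + x + q(x)\<close> and the component of \<open>q(x)\<close> in each
  layer depends only on the components of \<open>x\<close> in the lower layers. On a vertical subgroup \<open>N\<close> the map
  \<open>x \<mapsto> x + q(x)\<close> is therefore a composition of shears along layers contained in \<open>N\<close>, and shears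
  preserve the Hausdorff measure of \<open>N\<close>, because this measure is invariant under translations. Hence
  \<open>\<beta>\<^sub>d(N)\<close> is the supremum over \<open>u \<in> B\<close> of the measure of \<open>(u + B) \<inter> N\<close>. If \<open>r\<^sub>n < h\<^sub>\<ell>\<close>, any two
  vertical subgroups of dimension \<open>n\<close> are mapped onto each other by a linear isometry that preserves
  \<open>B\<close>; if \<open>r\<^sub>n = h\<^sub>\<ell>\<close>, there is only one. Since \<open>B\<close> is not known to be a Borel set, the invariance
  under shears is extended to arbitrary sets by Borel hulls.
\<close>

section \<open>Hausdorff measure\<close>

lemma hausdorff_weight_mono:
  assumes "A \<subseteq> B" "bounded B"
  shows "hausdorff_weight n A \<le> hausdorff_weight n B"
proof -
  have "bounded A" using assms bounded_subset by blast
  then have "(diameter A / 2) ^ n \<le> (diameter B / 2) ^ n"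
    using diameter_subset[OF assms] diameter_ge_0[of A] by (intro power_mono) auto
  then show ?thesis
    using assms by (auto simp: hausdorff_weight_def intro!: ennreal_leI mult_left_mono)
qed

lemma hausdorff_premeasure_le:
  assumes "A \<subseteq> (\<Union>i. E i)" "\<And>i. bounded (E i)" "\<And>i. diameter (E i) \<le> \<delta>"
  shows "hausdorff_premeasure n \<delta> A \<le> (\<Sum>i. hausdorff_weight n (E i))"
  unfolding hausdorff_premeasure_def using assms by (intro INF_lower) auto

lemma hausdorff_premeasure_empty:
  assumes "0 \<le> \<delta>"
  shows "hausdorff_premeasure n \<delta> {} = 0"
  using hausdorff_premeasure_le[of "{}" "\<lambda>_. {}" \<delta> n] assms by (simp add: hausdorff_weight_def)

lemma hausdorff_premeasure_mono:
  "A \<subseteq> B \<Longrightarrow> hausdorff_premeasure n \<delta> A \<le> hausdorff_premeasure n \<delta> B"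
  unfolding hausdorff_premeasure_def by (rule INF_superset_mono) auto

lemma hausdorff_premeasure_antimono:
  "\<delta> \<le> \<epsilon> \<Longrightarrow> hausdorff_premeasure n \<epsilon> A \<le> hausdorff_premeasure n \<delta> A"
  unfolding hausdorff_premeasure_def by (rule INF_superset_mono) (auto intro: order_trans)

text \<open>Finiteness makes the addition of \<open>e\<close> a strict increase, so some admissible
  cover lies below the enlarged infimum.\<close>

lemma hausdorff_premeasure_near_cover:
  assumes "hausdorff_premeasure n \<delta> A < \<infinity>" "0 < e"
  obtains E where "A \<subseteq> (\<Union>i. E i)" "\<And>i. bounded (E i)" "\<And>i. diameter (E i) \<le> \<delta>"
    "(\<Sum>i. hausdorff_weight n (E i)) \<le> hausdorff_premeasure n \<delta> A + ennreal e"
proof -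
  have "hausdorff_premeasure n \<delta> A < hausdorff_premeasure n \<delta> A + ennreal e"
    using assms by (cases "hausdorff_premeasure n \<delta> A") (auto simp flip: ennreal_plus intro!: ennreal_lessI)
  then obtain E where "A \<subseteq> (\<Union>i. E i)" "\<forall>i. bounded (E i) \<and> diameter (E i) \<le> \<delta>"
      "(\<Sum>i. hausdorff_weight n (E i)) < hausdorff_premeasure n \<delta> A + ennreal e"
    by (subst (asm) (1) hausdorff_premeasure_def) (auto simp: INF_less_iff)
  then show thesis by (intro that) (auto intro: less_imp_le)
qed

text \<open>Cover each \<open>A i\<close> with error at most \<open>e / 2 ^ (i + 1)\<close> and
  enumerate the resulting double sequence of sets by \<open>prod_decode\<close>; the errors add up
  to \<open>e\<close>.\<close>

lemma hausdorff_premeasure_UN_le: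
  fixes A :: "nat \<Rightarrow> 'a::metric_space set"
  shows "hausdorff_premeasure n \<delta> (\<Union>i. A i) \<le> (\<Sum>i. hausdorff_premeasure n \<delta> (A i))"
proof (rule ennreal_le_epsilon)
  fix e :: real
  assume fin: "(\<Sum>i. hausdorff_premeasure n \<delta> (A i)) < top" and e: "0 < e"
  have ex: "\<exists>E. A i \<subseteq> (\<Union>j. E j) \<and> (\<forall>j. bounded (E j) \<and> diameter (E j) \<le> \<delta>) \<and>
    (\<Sum>j. hausdorff_weight n (E j)) \<le> hausdorff_premeasure n \<delta> (A i) + ennreal (e * (1/2) ^ Suc i)" for i
  proof -
    have "hausdorff_premeasure n \<delta> (A i) < \<infinity>"
      using ennreal_suminf_lessD[OF fin] by (simp add: infinity_ennreal_def)
    moreover have "0 < e * (1/2) ^ Suc i" using e by simp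
    ultimately show ?thesis
      by (rule hausdorff_premeasure_near_cover[where n = n]) blast
  qed
  obtain E where E: "\<And>i. A i \<subseteq> (\<Union>j. E i j)" "\<And>i j. bounded (E i j)" "\<And>i j. diameter (E i j) \<le> \<delta>"
    and w: "\<And>i. (\<Sum>j. hausdorff_weight n (E i j)) \<le> hausdorff_premeasure n \<delta> (A i) + ennreal (e * (1/2) ^ Suc i)"
    using ex by metis
  define E' where "E' p = E (fst p) (snd p)" for p
  have "(\<Union>i. A i) \<subseteq> (\<Union>k. E' (prod_decode k))"
  proof
    fix x assume "x \<in> (\<Union>i. A i)"
    then obtain i j where "x \<in> E i j" using E(1) by blast
    then have "x \<in> E' (prod_decode (prod_encode (i, j)))" by (simp add: E'_def)
    then show "x \<in> (\<Union>k. E' (prod_decode k))" by blast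
  qed
  then have "hausdorff_premeasure n \<delta> (\<Union>i. A i) \<le> (\<Sum>k. hausdorff_weight n (E' (prod_decode k)))"
    by (rule hausdorff_premeasure_le) (simp_all add: E'_def E)
  also have "\<dots> = (\<Sum>i. \<Sum>j. hausdorff_weight n (E i j))"
    by (rule suminf_ennreal_2dimen) (simp add: E'_def)
  also have "\<dots> \<le> (\<Sum>i. hausdorff_premeasure n \<delta> (A i) + ennreal (e * (1/2) ^ Suc i))"
    by (intro suminf_le w) auto
  also have "\<dots> = (\<Sum>i. hausdorff_premeasure n \<delta> (A i)) + (\<Sum>i. ennreal (e * (1/2) ^ Suc i))"
    by (intro suminf_add[symmetric]) auto
  also have "(\<Sum>i. ennreal (e * (1/2) ^ Suc i)) = ennreal e"
    using sums_mult[OF power_half_series, of e] e by (intro sums_unique[symmetric]) simp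
  finally show "hausdorff_premeasure n \<delta> (\<Union>i. A i) \<le> (\<Sum>i. hausdorff_premeasure n \<delta> (A i)) + ennreal e" .
qed

text \<open>A set of diameter at most \<open>\<delta> < \<epsilon>\<close> cannot meet both
  \<open>A\<close> and \<open>B\<close>, so a cover of the union splits into a cover of
  \<open>A\<close> and a cover of \<open>B\<close> without increasing the total weight.\<close>

lemma hausdorff_premeasure_add_separated:
  assumes "\<And>a b. a \<in> A \<Longrightarrow> b \<in> B \<Longrightarrow> \<epsilon> \<le> dist a b" "\<delta> < \<epsilon>"
  shows "hausdorff_premeasure n \<delta> A + hausdorff_premeasure n \<delta> B \<le> hausdorff_premeasure n \<delta> (A \<union> B)"
  unfolding hausdorff_premeasure_def[of n \<delta> "A \<union> B"]
proof (rule INF_greatest, clarify)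
  fix E :: "nat \<Rightarrow> 'a set"
  assume cov: "A \<union> B \<subseteq> (\<Union>i. E i)" and E: "\<forall>i. bounded (E i) \<and> diameter (E i) \<le> \<delta>"
  have bdd: "bounded (E i \<inter> C)" for i C using E by (simp add: bounded_Int)
  have diam: "diameter (E i \<inter> C) \<le> \<delta>" for i C
    using E diameter_subset[of "E i \<inter> C" "E i"] by (metis Int_lower1 order_trans)
  have "E i \<inter> A = {} \<or> E i \<inter> B = {}" for i
  proof (rule ccontr)
    assume "\<not> ?thesis"
    then obtain a b where "a \<in> E i" "a \<in> A" "b \<in> E i" "b \<in> B" by blast
    then show False
      using assms diameter_bounded_bound[of "E i" a b] E by (smt (verit))
  qed
  \<comment> \<open>One of the two intersections is empty. Its weight 0 is a convention that matters
    for \<open>n = 0\<close>, where every nonempty set has weight 1.\<close>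
  then have w: "hausdorff_weight n (E i \<inter> A) + hausdorff_weight n (E i \<inter> B) \<le> hausdorff_weight n (E i)" for i
    using hausdorff_weight_mono[of "E i \<inter> A" "E i" n] hausdorff_weight_mono[of "E i \<inter> B" "E i" n] E
    by (metis Int_lower1 add.left_neutral add.right_neutral hausdorff_weight_def)
  have "hausdorff_premeasure n \<delta> A + hausdorff_premeasure n \<delta> B
      \<le> (\<Sum>i. hausdorff_weight n (E i \<inter> A)) + (\<Sum>i. hausdorff_weight n (E i \<inter> B))"
    using cov by (intro add_mono hausdorff_premeasure_le bdd diam) blast+
  also have "\<dots> = (\<Sum>i. hausdorff_weight n (E i \<inter> A) + hausdorff_weight n (E i \<inter> B))"
    by (intro suminf_add) auto
  also have "\<dots> \<le> (\<Sum>i. hausdorff_weight n (E i))"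
    by (intro suminf_le w) auto
  finally show "hausdorff_premeasure n \<delta> A + hausdorff_premeasure n \<delta> B \<le> (\<Sum>i. hausdorff_weight n (E i))" .
qed

section \<open>The Hausdorff outer measure\<close>

lemma hausdorff_premeasure_le_measure:
  "0 < \<delta> \<Longrightarrow> hausdorff_premeasure n \<delta> A \<le> hausdorff_measure n A"
  unfolding hausdorff_measure_def by (intro SUP_upper) auto

lemma hausdorff_measure_leI:
  "(\<And>\<delta>. 0 < \<delta> \<Longrightarrow> hausdorff_premeasure n \<delta> A \<le> c) \<Longrightarrow> hausdorff_measure n A \<le> c"
  unfolding hausdorff_measure_def by (intro SUP_least) auto

lemma hausdorff_measure_empty [simp]: "hausdorff_measure n ({} :: 'a::metric_space set) = 0"
proof -
  have "hausdorff_measure n ({} :: 'a set) \<le> 0"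
    by (rule hausdorff_measure_leI) (simp add: hausdorff_premeasure_empty)
  then show ?thesis by simp
qed

lemma hausdorff_measure_mono:
  "A \<subseteq> B \<Longrightarrow> hausdorff_measure n A \<le> hausdorff_measure n B"
  unfolding hausdorff_measure_def by (intro SUP_mono) (auto intro: hausdorff_premeasure_mono)

lemma hausdorff_measure_UN_le:
  fixes A :: "nat \<Rightarrow> 'a::metric_space set"
  shows "hausdorff_measure n (\<Union>i. A i) \<le> (\<Sum>i. hausdorff_measure n (A i))"
proof (rule hausdorff_measure_leI)
  fix \<delta> :: real assume "0 < \<delta>"
  then have "(\<Sum>i. hausdorff_premeasure n \<delta> (A i)) \<le> (\<Sum>i. hausdorff_measure n (A i))"
    by (intro suminf_le hausdorff_premeasure_le_measure) auto
  then show "hausdorff_premeasure n \<delta> (\<Union>i. A i) \<le> (\<Sum>i. hausdorff_measure n (A i))"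
    using hausdorff_premeasure_UN_le order_trans by blast
qed

lemma hausdorff_measure_Un_le:
  "hausdorff_measure n (A \<union> B) \<le> hausdorff_measure n A + hausdorff_measure n B"
proof -
  have "A \<union> B = (\<Union>i::nat. if i = 0 then A else if i = 1 then B else {})" (is "_ = (\<Union>i. ?C i)")
    by (auto split: if_splits)
  moreover have "(\<Sum>i. hausdorff_measure n (?C i)) = (\<Sum>i\<in>{0,1}. hausdorff_measure n (?C i))"
    by (rule suminf_finite) auto
  ultimately show ?thesis using hausdorff_measure_UN_le[of n ?C] by simp
qed

text \<open>Premeasures grow as the scale shrinks, so both can be compared at one common scale below
  \<open>\<epsilon>\<close>. The two scales are kept independent because the suprema defining the
  two measures are taken one after the other.\<close>

lemma hausdorff_measure_add_separated:
  assumes "\<And>a b. a \<in> A \<Longrightarrow> b \<in> B \<Longrightarrow> \<epsilon> \<le> dist a b" "0 < \<epsilon>"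
  shows "hausdorff_measure n A + hausdorff_measure n B \<le> hausdorff_measure n (A \<union> B)"
proof -
  have "hausdorff_premeasure n \<delta>\<^sub>1 A + hausdorff_premeasure n \<delta>\<^sub>2 B \<le> hausdorff_measure n (A \<union> B)"
    if "\<delta>\<^sub>1 > 0" "\<delta>\<^sub>2 > 0" for \<delta>\<^sub>1 \<delta>\<^sub>2
  proof -
    define \<delta> where "\<delta> = min (\<epsilon> / 2) (min \<delta>\<^sub>1 \<delta>\<^sub>2)"
    have \<delta>: "0 < \<delta>" "\<delta> < \<epsilon>" using that assms(2) by (auto simp: \<delta>_def min_def)
    have "hausdorff_premeasure n \<delta>\<^sub>1 A + hausdorff_premeasure n \<delta>\<^sub>2 B
        \<le> hausdorff_premeasure n \<delta> A + hausdorff_premeasure n \<delta> B"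
      by (intro add_mono hausdorff_premeasure_antimono) (auto simp: \<delta>_def)
    also have "\<dots> \<le> hausdorff_premeasure n \<delta> (A \<union> B)"
      by (rule hausdorff_premeasure_add_separated[OF assms(1) \<delta>(2)])
    also have "\<dots> \<le> hausdorff_measure n (A \<union> B)"
      by (rule hausdorff_premeasure_le_measure[OF \<delta>(1)])
    finally show ?thesis .
  qed
  then have "hausdorff_measure n A + hausdorff_premeasure n \<delta> B \<le> hausdorff_measure n (A \<union> B)"
    if "\<delta> > 0" for \<delta>
    using that unfolding hausdorff_measure_def[of n A]
    by (subst ennreal_SUP_add_left[symmetric]) (auto intro!: SUP_least)
  then show ?thesis
    unfolding hausdorff_measure_def[of n B]
    by (subst ennreal_SUP_add_right) (auto intro!: SUP_least)
qed

section \<open>Caratheodory measurability of the Borel sets\<close>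

lemma infdist_diff_le_dist: "\<bar>infdist x C - infdist y C\<bar> \<le> dist x y"
  using infdist_triangle[of x C y] infdist_triangle[of y C x] by (simp add: dist_commute)

text \<open>A finite sum has finite terms, which reduces the claim to the tails of a convergent real
  series.\<close>

lemma tendsto_suminf_tail_ennreal:
  fixes f :: "nat \<Rightarrow> ennreal"
  assumes "suminf f \<noteq> top"
  shows "(\<lambda>k. \<Sum>j. f (j + k)) \<longlonglongrightarrow> 0"
proof -
  define g where "g i = enn2real (f i)" for i
  have "f i < top" for i
    using ennreal_suminf_lessD[of f top] assms by (simp add: less_top)
  then have f: "f = (\<lambda>i. ennreal (g i))" by (simp add: g_def fun_eq_iff)
  have g0: "0 \<le> g i" for i by (simp add: g_def)
  have g: "summable g" using assms g0 unfolding f by (intro summable_suminf_not_top) auto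
  have "(\<lambda>k. ennreal (\<Sum>j. g (j + k))) \<longlonglongrightarrow> ennreal 0"
    by (intro tendsto_ennrealI suminf_exist_split2 g)
  moreover have "(\<Sum>j. f (j + k)) = ennreal (\<Sum>j. g (j + k))" for k
    unfolding f using g0 g by (intro suminf_ennreal2 summable_ignore_initial_segment) auto
  ultimately show ?thesis by simp
qed

text \<open>The sets at positive distance from \<open>C\<close> exhaust \<open>X - C\<close>; the measure of the remainder is a tail
  of the sum over rings around \<open>C\<close>, which converges because rings of the same parity are separated.\<close>

lemma hausdorff_measure_caratheodory_closed:
  fixes C X :: "'a::metric_space set"
  assumes C: "closed C"
  shows "hausdorff_measure n (X \<inter> C) + hausdorff_measure n (X - C) = hausdorff_measure n X"
\<comment> \<open>Treated first because \<open>infdist\<close> to the empty set is 0 by convention,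
  and because infinite measure makes the claim a case of subadditivity.\<close>
proof (cases "C = {} \<or> hausdorff_measure n X = \<infinity>")
  case True
  then show ?thesis
    using hausdorff_measure_Un_le[of n "X \<inter> C" "X - C"] by (auto simp: Un_Diff_Int Int_Diff_Un top_unique)
next
  case False
  define h where "h = hausdorff_measure n X"
  have fin: "h < \<infinity>" and ne: "C \<noteq> {}" using False by (auto simp: h_def less_top infinity_ennreal_def)
  define f where "f x = infdist x C" for x
  have f_pos: "x \<notin> C \<longleftrightarrow> 0 < f x" for x
    using in_closed_iff_infdist_zero[OF C ne] infdist_nonneg[of x C] by (auto simp: f_def order_less_le)
  have f_dist: "\<bar>f x - f y\<bar> \<le> dist x y" for x y
    unfolding f_def by (rule infdist_diff_le_dist)
  \<comment> \<open>\<open>D k\<close> keeps distance \<open>1 / (k + 1)\<close> from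
    \<open>C\<close>, and \<open>R k\<close> is the ring of points of \<open>X\<close> at distances
    between \<open>1 / (k + 2)\<close> and \<open>1 / (k + 1)\<close>.\<close>
  define D where "D k = {x \<in> X. 1 / real (Suc k) \<le> f x}" for k
  define R where "R k = {x \<in> X. 1 / real (Suc (Suc k)) \<le> f x \<and> f x < 1 / real (Suc k)}" for k
  \<comment> \<open>\<open>f\<close> is 1-Lipschitz, so a drop from at least \<open>a\<close> to at
    most \<open>b\<close> takes distance at least \<open>a - b\<close>.\<close>
  have sep: "hausdorff_measure n A + hausdorff_measure n B \<le> hausdorff_measure n (A \<union> B)"
    if "\<And>x. x \<in> A \<Longrightarrow> a \<le> f x" "\<And>x. x \<in> B \<Longrightarrow> f x \<le> b" "b < a" for A B a b
  proof (rule hausdorff_measure_add_separated[where \<epsilon> = "a - b"])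
    show "a - b \<le> dist x y" if "x \<in> A" "y \<in> B" for x y
      using f_dist[of x y] \<open>\<And>x. x \<in> A \<Longrightarrow> a \<le> f x\<close>[OF that(1)] \<open>\<And>x. x \<in> B \<Longrightarrow> f x \<le> b\<close>[OF that(2)]
      by linarith
  qed (use that in simp)
  \<comment> \<open>\<open>p\<close> selects the parity. Between two rings of the same parity lies a
    ring of the other parity, which separates them.\<close>
  have rings: "(\<Sum>j<m. hausdorff_measure n (R (2 * j + p))) \<le> h" for m p
  proof -
    have "(\<Sum>j<m. hausdorff_measure n (R (2 * j + p))) \<le> hausdorff_measure n (\<Union>j<m. R (2 * j + p))"
    proof (induction m)
      case (Suc m)
      show ?case
      \<comment> \<open>For \<open>m = 0\<close> and \<open>p = 0\<close> the threshold
        \<open>1 / real (2 * m + p)\<close> below would be \<open>1 / 0 = 0\<close>, so the empty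
        union is treated apart.\<close>
      proof (cases m)
        case 0
        then show ?thesis by (simp add: lessThan_Suc)
      next
        case m: (Suc k)
        have "hausdorff_measure n (\<Union>j<m. R (2 * j + p)) + hausdorff_measure n (R (2 * m + p))
            \<le> hausdorff_measure n ((\<Union>j<m. R (2 * j + p)) \<union> R (2 * m + p))"
        proof (rule sep)
          fix x assume "x \<in> (\<Union>j<m. R (2 * j + p))"
          then obtain j where "j < m" "x \<in> R (2 * j + p)" by blast
          then have "1 / real (Suc (Suc (2 * j + p))) \<le> f x" by (simp add: R_def)
          moreover have "1 / real (2 * m + p) \<le> 1 / real (Suc (Suc (2 * j + p)))"
            using \<open>j < m\<close> by (intro divide_left_mono) auto
          ultimately show "1 / real (2 * m + p) \<le> f x" by linarith
        next
          fix x assume "x \<in> R (2 * m + p)"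
          then show "f x \<le> 1 / real (Suc (2 * m + p))" by (simp add: R_def)
        next
          show "1 / real (Suc (2 * m + p)) < 1 / real (2 * m + p)"
            using m by (intro divide_strict_left_mono) auto
        qed
        moreover have "(\<Union>j<m. R (2 * j + p)) \<union> R (2 * m + p) = (\<Union>j<Suc m. R (2 * j + p))"
          by (auto simp: less_Suc_eq)
        ultimately show ?thesis
          using Suc.IH by (simp only: sum.lessThan_Suc) (meson add_right_mono order_trans)
      qed
    qed simp
    also have "\<dots> \<le> h" unfolding h_def by (rule hausdorff_measure_mono) (auto simp: R_def)
    finally show ?thesis .
  qed
  define a where "a k = hausdorff_measure n (R k)" for k
  \<comment> \<open>Even and odd rings contribute at most \<open>h\<close> each, so the whole series
    is bounded by \<open>h + h\<close>.\<close>
  have "(\<Sum>k<2 * m. a k) = (\<Sum>j<m. a (2 * j + 0)) + (\<Sum>j<m. a (2 * j + 1))" for m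
    by (induction m) (simp_all add: algebra_simps)
  then have even_sum: "(\<Sum>k<2 * m. a k) \<le> h + h" for m
    using add_mono[OF rings[of 0 m] rings[of 1 m]] by (simp only: a_def)
  have "(\<Sum>k<m. a k) \<le> h + h" for m
    using even_sum[of m] sum_mono2[of "{..<2 * m}" "{..<m}" a] by (auto intro: order_trans)
  then have "suminf a \<le> h + h"
    by (simp add: suminf_eq_SUP SUP_le_iff)
  then have sum_fin: "suminf a \<noteq> top"
    using fin by (auto simp: top_unique infinity_ennreal_def)
  have "X - C \<subseteq> D k \<union> (\<Union>j. R (j + k))" for k
  proof
    fix x assume x: "x \<in> X - C"
    show "x \<in> D k \<union> (\<Union>j. R (j + k))"
    proof (cases "x \<in> D k")
      case False
      have "0 < f x" using x f_pos by auto
      then obtain i where i: "1 / real (Suc i) < f x"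
        using reals_Archimedean[of "f x"] by (auto simp: inverse_eq_divide)
      \<comment> \<open>The least \<open>m\<close> with \<open>1 / (m + 1) \<le> f x\<close> puts
        \<open>x\<close> into the ring \<open>R (m - 1)\<close>; as \<open>x\<close> is not in
        \<open>D k\<close>, the index \<open>m - 1\<close> is at least \<open>k\<close>.\<close>
      define m where "m = (LEAST i. 1 / real (Suc i) \<le> f x)"
      have m: "1 / real (Suc m) \<le> f x"
        unfolding m_def by (rule LeastI[of _ i]) (use i in simp)
      have lt: "f x < 1 / real (Suc j)" if "j < m" for j
        using not_less_Least[of j "\<lambda>i. 1 / real (Suc i) \<le> f x"] that by (simp add: m_def)
      have "\<not> m \<le> k"
      proof
        assume "m \<le> k"
        then have "1 / real (Suc k) \<le> 1 / real (Suc m)" by (intro divide_left_mono) auto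
        with m False x show False by (auto simp: D_def)
      qed
      then obtain j where j: "m = Suc (j + k)" by (metis add.commute less_iff_Suc_add not_le)
      have "x \<in> R (j + k)" using m lt[of "j + k"] x by (auto simp: R_def j)
      then show ?thesis by blast
    qed auto
  qed
  then have tail: "hausdorff_measure n (X - C) \<le> hausdorff_measure n (D k) + (\<Sum>j. a (j + k))" for k
    using hausdorff_measure_mono[of "X - C" "D k \<union> (\<Union>j. R (j + k))" n]
      hausdorff_measure_Un_le[of n "D k" "\<Union>j. R (j + k)"] hausdorff_measure_UN_le[of n "\<lambda>j. R (j + k)"]
    unfolding a_def by (meson add_left_mono order_trans)
  have bound: "hausdorff_measure n (X \<inter> C) + hausdorff_measure n (X - C) \<le> h + (\<Sum>j. a (j + k))" for k
  proof -
    \<comment> \<open>\<open>f\<close> vanishes on \<open>X \<inter> C\<close>, so these two sets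
      are separated by \<open>1 / (k + 1)\<close>.\<close>
    have "hausdorff_measure n (D k) + hausdorff_measure n (X \<inter> C) \<le> hausdorff_measure n (D k \<union> (X \<inter> C))"
      by (rule sep[where a = "1 / real (Suc k)" and b = 0])
        (use f_pos in \<open>auto simp: D_def not_less[symmetric]\<close>)
    also have "\<dots> \<le> h" unfolding h_def by (rule hausdorff_measure_mono) (auto simp: D_def)
    finally have "hausdorff_measure n (X \<inter> C) + (hausdorff_measure n (D k) + (\<Sum>j. a (j + k)))
        \<le> h + (\<Sum>j. a (j + k))"
      by (metis add.assoc add.commute add_right_mono)
    then show ?thesis using tail[of k] by (meson add_left_mono order_trans)
  qed
  have "(\<lambda>k. h + (\<Sum>j. a (j + k))) \<longlonglongrightarrow> h + 0"
    by (intro tendsto_add tendsto_const tendsto_suminf_tail_ennreal sum_fin)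
  then have "hausdorff_measure n (X \<inter> C) + hausdorff_measure n (X - C) \<le> h"
    using bound by (intro LIMSEQ_le_const) auto
  moreover have "h \<le> hausdorff_measure n (X \<inter> C) + hausdorff_measure n (X - C)"
    using hausdorff_measure_Un_le[of n "X \<inter> C" "X - C"] by (simp add: Int_Diff_Un h_def)
  ultimately show ?thesis by (simp add: h_def)
qed

text \<open>The Caratheodory construction gives a measure on the lambda system of the outer measure.
  This system is a sigma-algebra containing the closed sets, hence all Borel sets.\<close>

lemma measure_space_hausdorff: "measure_space UNIV (sets borel) (hausdorff_measure n)"
  for n :: nat
proof -
  interpret P: sigma_algebra "UNIV :: 'a::metric_space set" "Pow UNIV"
    by (rule sigma_algebra_Pow)
  have "outer_measure_space (Pow UNIV) (hausdorff_measure n :: 'a set \<Rightarrow> _)"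
    by (auto simp: outer_measure_space_def positive_def increasing_def countably_subadditive_def
        intro: hausdorff_measure_mono hausdorff_measure_UN_le)
  note L = P.caratheodory_lemma[OF this]
  let ?L = "lambda_system UNIV (Pow UNIV) (hausdorff_measure n :: 'a set \<Rightarrow> _)"
  have closed: "C \<in> ?L" if "closed C" for C
    unfolding P.lambda_system_eq using that by (simp add: hausdorff_measure_caratheodory_closed)
  have "sets (borel :: 'a measure) = sigma_sets UNIV {S. closed S}"
    by (simp add: borel_eq_closed)
  also have "\<dots> \<subseteq> ?L"
    using L unfolding measure_space_def
    by (intro sigma_algebra.sigma_sets_subset) (use closed in auto)
  finally have "sets (borel :: 'a measure) \<subseteq> ?L" .
  moreover have "sigma_algebra UNIV (sets (borel :: 'a measure))"
    using sets.sigma_algebra_axioms[of "borel :: 'a measure"] by simp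
  ultimately show "measure_space UNIV (sets borel) (hausdorff_measure n :: 'a set \<Rightarrow> _)"
    using L by (auto simp: measure_space_def positive_def countably_additive_def)
qed

text \<open>The hull is the intersection over \<open>m\<close> of unions of closures of nearly
  optimal covers at scale \<open>1 / (m + 1)\<close>: taking closures changes no diameter and hence
  no weight. If the measure of \<open>A\<close> is infinite, the whole space serves.\<close>

lemma hausdorff_measure_borel_hull:
  fixes A :: "'a::metric_space set"
  obtains G where "G \<in> sets borel" "A \<subseteq> G" "hausdorff_measure n G = hausdorff_measure n A"
proof (cases "hausdorff_measure n A = \<infinity>")
  case True
  then show thesis
    using that[of UNIV] hausdorff_measure_mono[of A UNIV n] by (simp add: top_unique)
next
  case False
  have "\<exists>E. A \<subseteq> (\<Union>i. E i) \<and> (\<forall>i. bounded (E i) \<and> diameter (E i) \<le> 1 / real (Suc m)) \<and>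
      (\<Sum>i. hausdorff_weight n (E i)) \<le> hausdorff_premeasure n (1 / real (Suc m)) A + ennreal (1 / real (Suc m))" for m
  proof -
    have "hausdorff_premeasure n (1 / real (Suc m)) A < \<infinity>"
      using hausdorff_premeasure_le_measure[of "1 / real (Suc m)" n A] False
      by (simp add: less_top infinity_ennreal_def)
    then show ?thesis
      by (rule hausdorff_premeasure_near_cover[of _ _ _ "1 / real (Suc m)"]) auto
  qed
  then obtain E where E: "\<And>m. A \<subseteq> (\<Union>i. E m i)" "\<And>m i. bounded (E m i)" "\<And>m i. diameter (E m i) \<le> 1 / real (Suc m)"
    and w: "\<And>m. (\<Sum>i. hausdorff_weight n (E m i)) \<le> hausdorff_premeasure n (1 / real (Suc m)) A + ennreal (1 / real (Suc m))"
    by metis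
  define G where "G = (\<Inter>m. \<Union>i. closure (E m i))"
  have G: "G \<in> sets borel"
  proof -
    have "(\<Union>i. closure (E m i)) \<in> sets borel" for m
      by (rule sets.countable_UN) auto
    then show ?thesis unfolding G_def by (intro sets.countable_INT) auto
  qed
  have "A \<subseteq> (\<Union>i. closure (E m i))" for m
    by (rule order_trans[OF E(1)[of m]]) (intro UN_mono closure_subset order_refl)
  then have AG: "A \<subseteq> G" unfolding G_def by (rule INT_greatest)
  have "hausdorff_premeasure n \<delta> G \<le> hausdorff_measure n A" if "0 < \<delta>" for \<delta>
  proof (rule ennreal_le_epsilon)
    fix e :: real assume "0 < e"
    then have "0 < min \<delta> e" using that by simp
    \<comment> \<open>A single index makes the covers finer than \<open>\<delta>\<close> and their
      error smaller than \<open>e\<close>.\<close>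
    then obtain m where m: "1 / real (Suc m) < min \<delta> e"
      unfolding inverse_eq_divide[symmetric] by (metis reals_Archimedean)
    have "hausdorff_premeasure n \<delta> G \<le> hausdorff_premeasure n (1 / real (Suc m)) G"
      using m by (intro hausdorff_premeasure_antimono) simp
    also have "\<dots> \<le> (\<Sum>i. hausdorff_weight n (closure (E m i)))"
      by (rule hausdorff_premeasure_le) (use E in \<open>auto simp: G_def diameter_closure\<close>)
    also have "\<dots> = (\<Sum>i. hausdorff_weight n (E m i))"
      by (simp add: hausdorff_weight_def diameter_closure E(2) cong: if_cong)
    also have "\<dots> \<le> hausdorff_premeasure n (1 / real (Suc m)) A + ennreal (1 / real (Suc m))"
      by (rule w)
    also have "\<dots> \<le> hausdorff_measure n A + ennreal e"
      using m by (intro add_mono hausdorff_premeasure_le_measure ennreal_leI) auto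
    finally show "hausdorff_premeasure n \<delta> G \<le> hausdorff_measure n A + ennreal e" .
  qed
  then have "hausdorff_measure n G \<le> hausdorff_measure n A" by (rule hausdorff_measure_leI)
  then show thesis using that[OF G AG] hausdorff_measure_mono[OF AG] antisym by blast
qed

section \<open>Maps that do not increase distances\<close>

lemma hausdorff_measure_contraction_le:
  fixes f :: "'a::metric_space \<Rightarrow> 'b::metric_space"
  assumes f: "\<And>x y. dist (f x) (f y) \<le> dist x y"
  shows "hausdorff_measure n (f ` A) \<le> hausdorff_measure n A"
proof (rule hausdorff_measure_leI)
  fix \<delta> :: real assume "0 < \<delta>"
  have bdd: "bounded (f ` E)" and diam: "diameter (f ` E) \<le> diameter E" if "bounded E" for E
  proof -
    have le: "dist (f x) (f y) \<le> diameter E" if "x \<in> E" "y \<in> E" for x y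
      using f diameter_bounded_bound[OF \<open>bounded E\<close> that] order_trans by blast
    show "bounded (f ` E)"
      unfolding bounded_two_points using le by blast
    show "diameter (f ` E) \<le> diameter E"
    proof (cases "E = {}")
      case False
      then show ?thesis
        unfolding diameter_def[of "f ` E"] using le by (auto intro!: cSUP_least)
    qed simp
  qed
  have "hausdorff_premeasure n \<delta> (f ` A) \<le> hausdorff_premeasure n \<delta> A"
    unfolding hausdorff_premeasure_def[of n \<delta> A]
  proof (rule INF_greatest, clarify)
    fix E :: "nat \<Rightarrow> 'a set"
    assume cov: "A \<subseteq> (\<Union>i. E i)" and E: "\<forall>i. bounded (E i) \<and> diameter (E i) \<le> \<delta>"
    have "f ` A \<subseteq> (\<Union>i. f ` E i)" using cov by blast
    then have "hausdorff_premeasure n \<delta> (f ` A) \<le> (\<Sum>i. hausdorff_weight n (f ` E i))"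
      by (rule hausdorff_premeasure_le) (use E bdd diam order_trans in blast)+
    also have "\<dots> \<le> (\<Sum>i. hausdorff_weight n (E i))"
    proof (intro suminf_le)
      fix i
      have "(diameter (f ` E i) / 2) ^ n \<le> (diameter (E i) / 2) ^ n"
        using E diam[of "E i"] diameter_ge_0[OF bdd[of "E i"]] by (intro power_mono) auto
      then show "hausdorff_weight n (f ` E i) \<le> hausdorff_weight n (E i)"
        by (auto simp: hausdorff_weight_def intro!: ennreal_leI mult_left_mono)
    qed auto
    finally show "hausdorff_premeasure n \<delta> (f ` A) \<le> (\<Sum>i. hausdorff_weight n (E i))" .
  qed
  then show "hausdorff_premeasure n \<delta> (f ` A) \<le> hausdorff_measure n A"
    using hausdorff_premeasure_le_measure[OF \<open>0 < \<delta>\<close>] order_trans by blast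
qed

lemma hausdorff_measure_isometry:
  fixes f :: "'a::metric_space \<Rightarrow> 'a"
  assumes f: "\<And>x y. dist (f x) (f y) = dist x y" and "bij f"
  shows "hausdorff_measure n (f ` A) = hausdorff_measure n A"
proof (rule antisym)
  show "hausdorff_measure n (f ` A) \<le> hausdorff_measure n A"
    by (rule hausdorff_measure_contraction_le) (simp add: f)
  have "dist (inv f x) (inv f y) = dist x y" for x y
    using f[of "inv f x" "inv f y"] \<open>bij f\<close> by (simp add: bij_is_surj surj_f_inv_f)
  then have "hausdorff_measure n (inv f ` f ` A) \<le> hausdorff_measure n (f ` A)"
    by (intro hausdorff_measure_contraction_le) simp
  then show "hausdorff_measure n A \<le> hausdorff_measure n (f ` A)"
    using \<open>bij f\<close> by (simp add: bij_is_inj image_inv_f_f)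
qed

section \<open>Hausdorff measure on a subspace\<close>

text \<open>The Hausdorff measure concentrated on \<open>N\<close>, kept on the Borel sets of the
  whole space so that the integrals below involve only Borel functions on the whole space.\<close>

definition hausdorff_on :: "nat \<Rightarrow> 'a::euclidean_space set \<Rightarrow> 'a measure" where
  "hausdorff_on n N = measure_of UNIV (sets borel) (\<lambda>E. hausdorff_measure n (E \<inter> N))"

lemma sets_hausdorff_on [simp, measurable_cong]: "sets (hausdorff_on n N) = sets borel"
  using sets.sigma_sets_eq[of borel] by (simp add: hausdorff_on_def)

lemma space_hausdorff_on [simp]: "space (hausdorff_on n N) = UNIV"
  using sets_eq_imp_space_eq[OF sets_hausdorff_on] by simp

lemma emeasure_hausdorff_on:
  fixes N :: "'a::euclidean_space set"
  assumes "N \<in> sets borel" "A \<in> sets borel"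
  shows "emeasure (hausdorff_on n N) A = hausdorff_measure n (A \<inter> N)"
  unfolding hausdorff_on_def
proof (rule emeasure_measure_of_sigma)
  show "sigma_algebra UNIV (sets (borel :: 'a measure))"
    using sets.sigma_algebra_axioms[of "borel :: 'a measure"] by simp
  show "positive (sets borel) (\<lambda>E. hausdorff_measure n (E \<inter> N))"
    by (simp add: positive_def)
  show "countably_additive (sets borel) (\<lambda>E. hausdorff_measure n (E \<inter> N))"
  proof (rule countably_additiveI)
    fix F :: "nat \<Rightarrow> 'a set"
    assume F: "range F \<subseteq> sets borel" "disjoint_family F"
    have "countably_additive (sets (borel :: 'a measure)) (hausdorff_measure n)"
      using measure_space_hausdorff[of n, where 'a = 'a] by (simp add: measure_space_def)
    moreover have "range (\<lambda>i. F i \<inter> N) \<subseteq> sets borel" "(\<Union>i. F i \<inter> N) \<in> sets borel"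
      using F(1) assms(1) by (auto intro!: sets.countable_UN)
    moreover have "disjoint_family (\<lambda>i. F i \<inter> N)"
      using F(2) unfolding disjoint_family_on_def by blast
    ultimately have "(\<Sum>i. hausdorff_measure n (F i \<inter> N)) = hausdorff_measure n (\<Union>i. F i \<inter> N)"
      by (simp add: countably_additive_def)
    then show "(\<Sum>i. hausdorff_measure n (F i \<inter> N)) = hausdorff_measure n ((\<Union>i. F i) \<inter> N)"
      by simp
  qed
qed (use assms in auto)

text \<open>A finite cover becomes a sequence by appending empty sets, whose weight is 0.\<close>

lemma hausdorff_premeasure_le_sum:
  assumes "finite I" "A \<subseteq> (\<Union>i\<in>I. C i)" "\<And>i. i \<in> I \<Longrightarrow> bounded (C i)"
    "\<And>i. i \<in> I \<Longrightarrow> diameter (C i) \<le> \<delta>" "0 \<le> \<delta>"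
  shows "hausdorff_premeasure n \<delta> A \<le> (\<Sum>i\<in>I. hausdorff_weight n (C i))"
proof -
  obtain e where e: "bij_betw e {..<card I} I"
    using ex_bij_betw_nat_finite[OF assms(1)] by (auto simp: atLeast0LessThan)
  define E where "E k = (if k < card I then C (e k) else {})" for k
  have eI: "e k \<in> I" if "k < card I" for k using e that by (auto simp: bij_betw_def)
  have "A \<subseteq> (\<Union>k. E k)"
  proof
    fix x assume "x \<in> A"
    then obtain i where i: "i \<in> I" "x \<in> C i" using assms(2) by blast
    then obtain k where "k < card I" "e k = i"
      using e by (metis bij_betw_imp_surj_on imageE lessThan_iff)
    with i have "x \<in> E k" by (simp add: E_def)
    then show "x \<in> (\<Union>k. E k)" by blast
  qed
  then have "hausdorff_premeasure n \<delta> A \<le> (\<Sum>k. hausdorff_weight n (E k))"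
    by (rule hausdorff_premeasure_le) (use assms eI in \<open>auto simp: E_def\<close>)
  also have "\<dots> = (\<Sum>k<card I. hausdorff_weight n (E k))"
    by (rule suminf_finite) (auto simp: E_def hausdorff_weight_def)
  also have "\<dots> = (\<Sum>k<card I. hausdorff_weight n (C (e k)))"
    by (rule sum.cong) (auto simp: E_def)
  also have "\<dots> = (\<Sum>i\<in>I. hausdorff_weight n (C i))"
    by (rule sum.reindex_bij_betw[OF e])
  finally show ?thesis .
qed

lemma norm_le_sum_orthonormal:
  fixes B :: "'a::euclidean_space set"
  assumes "pairwise orthogonal B" "\<And>b. b \<in> B \<Longrightarrow> norm b = 1" "finite B" "x \<in> span B"
  shows "norm x \<le> (\<Sum>b\<in>B. \<bar>x \<bullet> b\<bar>)"
proof -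
  have "norm x = norm (\<Sum>b\<in>B. (x \<bullet> b) *\<^sub>R b)"
    using orthonormal_basis_expand[OF assms(1,2,4,3)] by simp
  also have "\<dots> \<le> (\<Sum>b\<in>B. norm ((x \<bullet> b) *\<^sub>R b))" by (rule norm_sum)
  also have "\<dots> = (\<Sum>b\<in>B. \<bar>x \<bullet> b\<bar>)" using assms(2) by simp
  finally show ?thesis .
qed

text \<open>Cut the box into \<open>(2 * R * m) ^ n\<close> cubes of side \<open>1 / m\<close>. Each
  has diameter at most \<open>n / m\<close>, and the resulting bound
  \<open>unit_ball_vol n * (R * n) ^ n\<close> on the total weight does not depend on
  \<open>m\<close>.\<close>

lemma hausdorff_measure_box_finite:
  fixes B :: "'a::euclidean_space set" and R :: nat
  assumes B: "pairwise orthogonal B" "\<And>b. b \<in> B \<Longrightarrow> norm b = 1" "finite B"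
  shows "hausdorff_measure (card B) {x \<in> span B. \<forall>b\<in>B. - real R \<le> x \<bullet> b \<and> x \<bullet> b < real R} < \<infinity>"
proof -
  define n where "n = card B"
  define c where "c = unit_ball_vol (real n) * (real R * real n) ^ n"
  define Q where "Q = {x \<in> span B. \<forall>b\<in>B. - real R \<le> x \<bullet> b \<and> x \<bullet> b < real R}"
  have "hausdorff_premeasure n \<delta> Q \<le> ennreal c" if \<delta>: "0 < \<delta>" for \<delta>
  proof -
    obtain m where m: "m > 0" "real n / real m < \<delta>"
    proof -
      obtain k where k: "real n < real k * \<delta>" using reals_Archimedean3[OF \<delta>] by blast
      then have "k > 0" using \<delta> by (cases "k = 0") auto
      then show thesis using k by (intro that[of k]) (auto simp: field_simps)
    qed
    define I where "I = PiE B (\<lambda>_. {- int (R * m)..<int (R * m)})"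
    \<comment> \<open>After scaling by \<open>m\<close> the cubes have integer corners, and
      \<open>i b\<close> is the lower end in direction \<open>b\<close>.\<close>
    define C where "C i = {x \<in> span B. \<forall>b\<in>B. real_of_int (i b) \<le> real m * (x \<bullet> b) \<and>
        real m * (x \<bullet> b) \<le> real_of_int (i b) + 1}" for i
    have fin: "finite I" unfolding I_def by (intro finite_PiE B) auto
    have "card {- int (R * m)..<int (R * m)} = 2 * R * m"
      by (simp only: card_atLeastLessThan_int)
    then have card: "card I = (2 * R * m) ^ n"
      unfolding I_def using B(3) by (simp add: card_PiE n_def)
    have close: "dist x y \<le> real n / real m" if "x \<in> C i" "y \<in> C i" for x y i
    proof -
      have "norm (x - y) \<le> (\<Sum>b\<in>B. \<bar>(x - y) \<bullet> b\<bar>)"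
        using that by (intro norm_le_sum_orthonormal B) (auto simp: C_def span_diff)
      also have "\<dots> \<le> (\<Sum>b\<in>B. 1 / real m)"
      proof (rule sum_mono)
        fix b assume "b \<in> B"
        then have "\<bar>real m * (x \<bullet> b) - real m * (y \<bullet> b)\<bar> \<le> 1" using that unfolding C_def by fastforce
        then have "real m * \<bar>(x - y) \<bullet> b\<bar> \<le> 1"
          by (simp add: inner_diff_left abs_mult flip: right_diff_distrib)
        then show "\<bar>(x - y) \<bullet> b\<bar> \<le> 1 / real m" using m(1) by (simp add: field_simps)
      qed
      finally show ?thesis by (simp add: dist_norm n_def)
    qed
    have bdd: "bounded (C i)" for i
      unfolding bounded_two_points using close by blast
    have diam: "diameter (C i) \<le> real n / real m" for i
      by (rule diameter_le) (use close in \<open>auto simp: dist_norm\<close>)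
    have "Q \<subseteq> (\<Union>i\<in>I. C i)"
    proof
      fix x assume x: "x \<in> Q"
      \<comment> \<open>The box is half-open, so rounding down never yields the index
        \<open>R * m\<close>, and \<open>2 * R * m\<close> cubes per direction are enough.\<close>
      define i where "i = restrict (\<lambda>b. \<lfloor>real m * (x \<bullet> b)\<rfloor>) B"
      have "i \<in> I"
      proof -
        have "- int (R * m) \<le> \<lfloor>real m * (x \<bullet> b)\<rfloor> \<and> \<lfloor>real m * (x \<bullet> b)\<rfloor> < int (R * m)" if "b \<in> B" for b
        proof -
          have "- real R \<le> x \<bullet> b" "x \<bullet> b < real R" using x that by (auto simp: Q_def)
          then have "real m * (- real R) \<le> real m * (x \<bullet> b)" "real m * (x \<bullet> b) < real m * real R"
            using m(1) by (simp_all only: mult_left_mono mult_strict_left_mono of_nat_0_le_iff of_nat_0_less_iff)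
          then show ?thesis by (auto simp: le_floor_iff floor_less_iff mult.commute)
        qed
        then show ?thesis by (auto simp: I_def i_def)
      qed
      moreover have "x \<in> C i"
        using x by (auto simp: C_def i_def Q_def intro: less_imp_le real_of_int_floor_add_one_gt)
      ultimately show "x \<in> (\<Union>i\<in>I. C i)" by blast
    qed
    then have "hausdorff_premeasure n \<delta> Q \<le> (\<Sum>i\<in>I. hausdorff_weight n (C i))"
      by (rule hausdorff_premeasure_le_sum[OF fin]) (use bdd order_trans[OF diam less_imp_le[OF m(2)]] \<delta> in auto)
    also have "\<dots> \<le> (\<Sum>i\<in>I. ennreal (unit_ball_vol (real n) * (real n / real m / 2) ^ n))"
    proof (rule sum_mono)
      fix i
      have "(diameter (C i) / 2) ^ n \<le> (real n / real m / 2) ^ n"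
        using diam[of i] diameter_ge_0[OF bdd[of i]] by (intro power_mono) auto
      then show "hausdorff_weight n (C i) \<le> ennreal (unit_ball_vol (real n) * (real n / real m / 2) ^ n)"
        by (auto simp: hausdorff_weight_def intro!: ennreal_leI mult_left_mono)
    qed
    also have "\<dots> = ennreal (real (card I) * (unit_ball_vol (real n) * (real n / real m / 2) ^ n))"
      by (simp add: ennreal_mult ennreal_of_nat_eq_real_of_nat)
    also have "real (card I) * (unit_ball_vol (real n) * (real n / real m / 2) ^ n) = c"
    proof -
      have "real (card I) * (real n / real m / 2) ^ n = ((2 * real R * real m) * (real n / real m / 2)) ^ n"
        unfolding card power_mult_distrib by simp
      also have "(2 * real R * real m) * (real n / real m / 2) = real R * real n"
        using m(1) by simp
      finally show ?thesis unfolding c_def by (simp only: mult.left_commute)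
    qed
    finally show ?thesis .
  qed
  then have "hausdorff_measure n Q \<le> ennreal c" by (rule hausdorff_measure_leI)
  also have "\<dots> < \<infinity>" by simp
  finally show ?thesis by (simp add: Q_def n_def)
qed

text \<open>Fubini's theorem for the shears relies on this. The sets \<open>Q R\<close> cut boxes of
  finite measure out of \<open>N\<close> and exhaust the whole space.\<close>

lemma sigma_finite_hausdorff_on:
  fixes N :: "'a::euclidean_space set"
  assumes N: "subspace N" "dim N = n"
  shows "sigma_finite_measure (hausdorff_on n N)"
proof -
  obtain B where B: "pairwise orthogonal B" "\<And>x. x \<in> B \<Longrightarrow> norm x = 1"
      "independent B" "card B = dim N" "span B = N"
    using orthonormal_basis_subspace[OF N(1)] by metis
  have fin: "finite B" using B(3) by (rule independent_imp_finite)
  have Nb: "N \<in> sets borel" using closed_subspace[OF N(1)] by simp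
  define Q where "Q R = {x. \<forall>b\<in>B. - real R \<le> x \<bullet> b \<and> x \<bullet> b < real R}" for R :: nat
  have Qb: "Q R \<in> sets borel" for R
  proof -
    have "Q R = (\<Inter>b\<in>B. {x. - real R \<le> x \<bullet> b} \<inter> {x. x \<bullet> b < real R})" by (auto simp: Q_def)
    moreover have "{x. - real R \<le> x \<bullet> b} \<inter> {x. x \<bullet> b < real R} \<in> sets borel" for b :: 'a
      by measurable
    ultimately show ?thesis using fin by (cases "B = {}") (auto intro!: sets.finite_INT)
  qed
  have QN: "Q R \<inter> N = {x \<in> span B. \<forall>b\<in>B. - real R \<le> x \<bullet> b \<and> x \<bullet> b < real R}" for R
    using B(5) by (auto simp: Q_def)
  have cov: "(\<Union>R. Q R) = UNIV"
  proof -
    have "\<exists>R. x \<in> Q R" for x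
    proof -
      obtain R :: nat where R: "norm x < real R" using reals_Archimedean2 by blast
      have "\<bar>x \<bullet> b\<bar> \<le> norm x" if "b \<in> B" for b
        using Cauchy_Schwarz_ineq2[of x b] B(2)[OF that] by simp
      then have "x \<in> Q R" using R unfolding Q_def by (fastforce simp: abs_le_iff)
      then show ?thesis ..
    qed
    then show ?thesis by blast
  qed
  have "hausdorff_measure n (Q R \<inter> N) \<noteq> \<infinity>" for R
    using hausdorff_measure_box_finite[OF B(1,2) fin, of R] N(2) B(4) by (simp add: QN less_top)
  then show ?thesis
  proof (unfold_locales, goal_cases)
    case 1
    then show "\<exists>A. countable A \<and> A \<subseteq> sets (hausdorff_on n N) \<and> \<Union> A = space (hausdorff_on n N) \<and>
        (\<forall>a\<in>A. emeasure (hausdorff_on n N) a \<noteq> \<infinity>)"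
      using Qb cov by (intro exI[of _ "range Q"]) (auto simp: emeasure_hausdorff_on[OF Nb])
  qed
qed

section \<open>Translations and shears\<close>

lemma hausdorff_measure_translate:
  fixes A :: "'a::real_normed_vector set"
  shows "hausdorff_measure n ((+) c ` A) = hausdorff_measure n A"
  by (rule hausdorff_measure_isometry) (auto simp: bij_plus_right)

lemma hausdorff_on_translate:
  fixes N :: "'a::euclidean_space set"
  assumes N: "subspace N" and c: "c \<in> N"
  shows "distr (hausdorff_on n N) borel ((+) c) = hausdorff_on n N"
proof (rule measure_eqI)
  fix A assume "A \<in> sets (distr (hausdorff_on n N) borel ((+) c))"
  then have A: "A \<in> sets borel" by simp
  have Nb: "N \<in> sets borel" using closed_subspace[OF N(1)] by simp
  have A': "(+) c -` A \<in> sets borel"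
    using measurable_sets[of "(+) c" borel borel A] A by simp
  have "(+) c ` ((+) c -` A \<inter> N) = A \<inter> N"
  proof
    show "A \<inter> N \<subseteq> (+) c ` ((+) c -` A \<inter> N)"
    proof
      fix x assume "x \<in> A \<inter> N"
      then have "x - c \<in> (+) c -` A \<inter> N" using N c by (auto simp: subspace_diff)
      then show "x \<in> (+) c ` ((+) c -` A \<inter> N)" by force
    qed
  qed (use N c in \<open>auto simp: subspace_add\<close>)
  then have "hausdorff_measure n ((+) c -` A \<inter> N) = hausdorff_measure n (A \<inter> N)"
    by (metis hausdorff_measure_translate)
  then show "emeasure (distr (hausdorff_on n N) borel ((+) c)) A = emeasure (hausdorff_on n N) A"
    using A A' by (simp add: emeasure_distr emeasure_hausdorff_on[OF Nb])
qed simp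

lemma nn_integral_hausdorff_on_translate:
  fixes N :: "'a::euclidean_space set"
  assumes "subspace N" "c \<in> N" "f \<in> borel_measurable borel"
  shows "(\<integral>\<^sup>+ x. f (c + x) \<partial>hausdorff_on n N) = (\<integral>\<^sup>+ x. f x \<partial>hausdorff_on n N)"
proof -
  have "(\<integral>\<^sup>+ x. f (c + x) \<partial>hausdorff_on n N) = (\<integral>\<^sup>+ x. f x \<partial>distr (hausdorff_on n N) borel ((+) c))"
    using assms(3) by (subst nn_integral_distr) auto
  then show ?thesis by (simp add: hausdorff_on_translate assms)
qed

lemma nn_integral_lborel_translate:
  fixes f :: "'a::euclidean_space \<Rightarrow> ennreal"
  assumes "f \<in> borel_measurable borel"
  shows "(\<integral>\<^sup>+ x. f (c + x) \<partial>lborel) = (\<integral>\<^sup>+ x. f x \<partial>lborel)"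
proof -
  have "(\<integral>\<^sup>+ x. f (c + x) \<partial>lborel) = (\<integral>\<^sup>+ x. f x \<partial>distr lborel borel ((+) c))"
    using assms by (subst nn_integral_distr) auto
  then show ?thesis by (simp add: lborel_distr_plus)
qed

text \<open>Invariance of the measure under translations along the shear direction turns the shear of
  the variable on \<open>N\<close> into a translation of an auxiliary Lebesgue variable.\<close>

lemma hausdorff_measure_shear_borel:
  fixes N :: "'a::euclidean_space set" and P g :: "'a \<Rightarrow> 'a"
  assumes N: "subspace N" "dim N = n"
    and P: "linear P" "\<And>x. P x \<in> N"
    and g: "g \<in> borel_measurable borel" "\<And>x. P (g x) = g x" "\<And>x z. g (x + P z) = g x"
    and A: "A \<in> sets borel"
  shows "hausdorff_measure n ({x. x + g x \<in> A} \<inter> N) = hausdorff_measure n (A \<inter> N)"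
proof -
  define M where "M = hausdorff_on n N"
  have sM [simp, measurable_cong]: "sets M = sets borel" by (simp add: M_def)
  have Nb: "N \<in> sets borel" using closed_subspace[OF N(1)] by simp
  interpret M: sigma_finite_measure M unfolding M_def by (rule sigma_finite_hausdorff_on[OF N])
  interpret M_lborel: pair_sigma_finite M lborel ..
  have P_meas [measurable]: "P \<in> borel_measurable borel"
    using linear_continuous_on[of P UNIV] P(1)
    by (intro borel_measurable_continuous_onI) (simp add: linear_conv_bounded_linear)
  note g(1)[measurable] A[measurable]
  \<comment> \<open>\<open>K\<close> has Lebesgue measure 1, so an auxiliary integral over
    \<open>z\<close> in \<open>K\<close> changes nothing. The variable \<open>z\<close> ranges over
    the whole space and moves \<open>x\<close> only through \<open>P z\<close>.\<close>
  define K :: "'a set" where "K = cbox 0 One"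
  have K [measurable]: "K \<in> sets borel" by (simp add: K_def)
  have K1: "emeasure lborel K = 1" by (simp add: K_def)
  define S where "S = {x. x + g x \<in> A}"
  have S [measurable]: "S \<in> sets borel" unfolding S_def by measurable
  have P_diff: "P (x - y) = P x - P y" for x y using P(1) by (rule linear_diff)
  have shift: "(\<integral>\<^sup>+ x. f (x + P z) \<partial>M) = (\<integral>\<^sup>+ x. f x \<partial>M)" if "f \<in> borel_measurable borel" for f z
    using nn_integral_hausdorff_on_translate[OF N(1) P(2) that] by (simp add: M_def add.commute)
  have "emeasure M S = (\<integral>\<^sup>+ x. \<integral>\<^sup>+ z. indicator A (x + g x) * indicator K z \<partial>lborel \<partial>M)"
  proof -
    have "(\<integral>\<^sup>+ x. \<integral>\<^sup>+ z. indicator A (x + g x) * indicator K z \<partial>lborel \<partial>M) = (\<integral>\<^sup>+ x. indicator S x \<partial>M)"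
      by (intro nn_integral_cong) (simp add: nn_integral_cmult K1, simp add: S_def indicator_def)
    then show ?thesis by simp
  qed
  also have "\<dots> = (\<integral>\<^sup>+ z. \<integral>\<^sup>+ x. indicator A (x + g x) * indicator K z \<partial>M \<partial>lborel)"
    by (rule M_lborel.Fubini'[symmetric]) measurable
  \<comment> \<open>Translate \<open>x\<close> by \<open>P z\<close>, which lies in
    \<open>N\<close>; \<open>g\<close> is constant in this direction.\<close>
  also have "\<dots> = (\<integral>\<^sup>+ z. \<integral>\<^sup>+ x. indicator A (x + P z + g x) * indicator K z \<partial>M \<partial>lborel)"
  proof (rule nn_integral_cong)
    fix z
    show "(\<integral>\<^sup>+ x. indicator A (x + g x) * indicator K z \<partial>M)
        = (\<integral>\<^sup>+ x. indicator A (x + P z + g x) * indicator K z \<partial>M)"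
      using shift[of "\<lambda>x. indicator A (x + g x) * indicator K z" z] by (simp add: g(3))
  qed
  also have "\<dots> = (\<integral>\<^sup>+ x. \<integral>\<^sup>+ z. indicator A (x + P z + g x) * indicator K z \<partial>lborel \<partial>M)"
    by (rule M_lborel.Fubini') measurable
  \<comment> \<open>Substituting \<open>z - g x\<close> for \<open>z\<close> cancels the shear in
    \<open>A\<close>, because \<open>P (g x) = g x\<close>, and moves it into
    \<open>K\<close>.\<close>
  also have "\<dots> = (\<integral>\<^sup>+ x. \<integral>\<^sup>+ z. indicator A (x + P z) * indicator K (- g x + z) \<partial>lborel \<partial>M)"
  proof (rule nn_integral_cong)
    fix x
    show "(\<integral>\<^sup>+ z. indicator A (x + P z + g x) * indicator K z \<partial>lborel)
        = (\<integral>\<^sup>+ z. indicator A (x + P z) * indicator K (- g x + z) \<partial>lborel)"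
      using nn_integral_lborel_translate[of "\<lambda>z. indicator A (x + P z + g x) * indicator K z" "- g x"]
      by (simp add: P_diff g(2) algebra_simps)
  qed
  also have "\<dots> = (\<integral>\<^sup>+ z. \<integral>\<^sup>+ x. indicator A (x + P z) * indicator K (- g x + z) \<partial>M \<partial>lborel)"
    by (rule M_lborel.Fubini'[symmetric]) measurable
  \<comment> \<open>The translation of \<open>x\<close> by \<open>P z\<close> is undone, and
    \<open>g x\<close> is again unchanged.\<close>
  also have "\<dots> = (\<integral>\<^sup>+ z. \<integral>\<^sup>+ x. indicator A x * indicator K (- g x + z) \<partial>M \<partial>lborel)"
  proof (rule nn_integral_cong)
    fix z
    show "(\<integral>\<^sup>+ x. indicator A (x + P z) * indicator K (- g x + z) \<partial>M)
        = (\<integral>\<^sup>+ x. indicator A x * indicator K (- g x + z) \<partial>M)"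
      using shift[of "\<lambda>x. indicator A x * indicator K (- g x + z)" z] by (simp add: g(3))
  qed
  also have "\<dots> = (\<integral>\<^sup>+ x. \<integral>\<^sup>+ z. indicator A x * indicator K (- g x + z) \<partial>lborel \<partial>M)"
    by (rule M_lborel.Fubini') measurable
  \<comment> \<open>The translate of \<open>K\<close> by \<open>g x\<close> still has Lebesgue
    measure 1.\<close>
  also have "\<dots> = (\<integral>\<^sup>+ x. indicator A x \<partial>M)"
  proof (rule nn_integral_cong)
    fix x
    show "(\<integral>\<^sup>+ z. indicator A x * indicator K (- g x + z) \<partial>lborel) = indicator A x"
      using nn_integral_lborel_translate[of "indicator K" "- g x"]
      by (simp add: nn_integral_cmult K1)
  qed
  also have "\<dots> = emeasure M A" by simp
  finally show ?thesis
    by (simp add: M_def emeasure_hausdorff_on[OF Nb] A S flip: S_def)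
qed

text \<open>A Borel hull of \<open>A \<inter> N\<close> gives one inequality for arbitrary
  \<open>A\<close>; the other is the same inequality for the inverse shear, with \<open>- g\<close>
  in place of \<open>g\<close>.\<close>

lemma hausdorff_measure_shear:
  fixes N :: "'a::euclidean_space set" and P g :: "'a \<Rightarrow> 'a"
  assumes N: "subspace N" "dim N = n"
    and P: "linear P" "\<And>x. P x \<in> N"
    and g: "g \<in> borel_measurable borel" "\<And>x. P (g x) = g x" "\<And>x z. g (x + P z) = g x"
  shows "hausdorff_measure n ({x. x + g x \<in> A} \<inter> N) = hausdorff_measure n (A \<inter> N)"
proof -
  have le: "hausdorff_measure n ({x. x + g x \<in> A} \<inter> N) \<le> hausdorff_measure n (A \<inter> N)"
    if g: "g \<in> borel_measurable borel" "\<And>x. P (g x) = g x" "\<And>x z. g (x + P z) = g x"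
    for g :: "'a \<Rightarrow> 'a" and A
  proof -
    obtain G where G: "G \<in> sets borel" "A \<inter> N \<subseteq> G" "hausdorff_measure n G = hausdorff_measure n (A \<inter> N)"
      by (rule hausdorff_measure_borel_hull)
    have "x + g x \<in> N" if "x \<in> N" for x
      using N(1) P(2)[of "g x"] that by (simp add: g(2) subspace_add)
    then have "hausdorff_measure n ({x. x + g x \<in> A} \<inter> N) \<le> hausdorff_measure n ({x. x + g x \<in> G} \<inter> N)"
      using G(2) by (intro hausdorff_measure_mono) auto
    also have "\<dots> = hausdorff_measure n (G \<inter> N)"
      by (rule hausdorff_measure_shear_borel[OF N P g G(1)])
    also have "\<dots> \<le> hausdorff_measure n G" by (rule hausdorff_measure_mono) simp
    finally show ?thesis by (simp add: G(3))
  qed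
  show ?thesis
  proof (rule antisym)
    show "hausdorff_measure n ({x. x + g x \<in> A} \<inter> N) \<le> hausdorff_measure n (A \<inter> N)"
      by (rule le[OF g])
    \<comment> \<open>Since \<open>g x\<close> lies in the range of \<open>P\<close>,
      \<open>g\<close> does not change along its own shear, so \<open>x - g x\<close> inverts
      \<open>x + g x\<close>.\<close>
    have "g (x - g x) = g x" for x
      using g(3)[of x "- g x"] linear_neg[OF P(1), of "g x"] by (simp add: g(2))
    then have "A = {x. x + - g x \<in> {x. x + g x \<in> A}}" by simp
    also have "hausdorff_measure n (\<dots> \<inter> N) \<le> hausdorff_measure n ({x. x + g x \<in> A} \<inter> N)"
      by (rule le) (use g linear_neg[OF P(1)] in auto)
    finally show "hausdorff_measure n (A \<inter> N) \<le> hausdorff_measure n ({x. x + g x \<in> A} \<inter> N)" .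
  qed
qed

section \<open>The group law along a vertical subgroup\<close>

text \<open>Naturality in the letters: a word in two functions, evaluated at a point, is the word in
  their values. This is how continuity of nested brackets is carried over to
  \<open>bch\<close>.\<close>

lemma map_dynkin_word: "map f (dynkin_word x y p) = dynkin_word (f x) (f y) p"
  by (simp add: dynkin_word_def map_concat comp_def case_prod_unfold)

lemma length_dynkin_word: "length (dynkin_word x y p) = dynkin_degree p"
  by (induction p) (auto simp: dynkin_word_def dynkin_degree_def)

lemma set_dynkin_word: "set (dynkin_word x y p) \<subseteq> {x, y}"
proof
  fix z assume "z \<in> set (dynkin_word x y p)"
  then obtain ab where "z \<in> set (replicate (fst ab) x @ replicate (snd ab) y)"
    by (auto simp only: dynkin_word_def set_concat set_map case_prod_unfold)
  then show "z \<in> {x, y}" by (auto simp only: set_append in_set_replicate)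
qed

lemma length_le_dynkin_degree:
  "\<forall>(a, b)\<in>set p. 0 < a + b \<Longrightarrow> length p \<le> dynkin_degree p"
proof (induction p)
  case (Cons ab p)
  then show ?case by (cases ab) (auto simp: dynkin_degree_def)
qed (simp add: dynkin_degree_def)

section \<open>Components in the layers and the structure of the product\<close>

context homogeneous_group
begin

text \<open>The coordinate of the direct sum decomposition, taken from the grading alone and not
  from the scalar product. For \<open>k\<close> outside \<open>{1..s}\<close> it is
  \<open>undefined\<close>, by extensionality.\<close>

definition layer_component :: "nat \<Rightarrow> 'a \<Rightarrow> 'a" where
  "layer_component k x = (THE f. f \<in> (\<Pi>\<^sub>E j\<in>{1..s}. H j) \<and> x = (\<Sum>j=1..s. f j)) k"

lemma layer_component_in: "k \<in> {1..s} \<Longrightarrow> layer_component k x \<in> H k"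
  and sum_layer_component: "(\<Sum>k=1..s. layer_component k x) = x"
  using theI'[OF direct_sum[of x]] by (auto simp: layer_component_def Pi_iff)

lemma layer_component_eqI:
  assumes "\<And>j. j \<in> {1..s} \<Longrightarrow> f j \<in> H j" "x = (\<Sum>j=1..s. f j)" "k \<in> {1..s}"
  shows "layer_component k x = f k"
proof -
  have "restrict f {1..s} \<in> (\<Pi>\<^sub>E j\<in>{1..s}. H j) \<and> x = (\<Sum>j=1..s. restrict f {1..s} j)"
    using assms by auto
  then have "(THE f. f \<in> (\<Pi>\<^sub>E j\<in>{1..s}. H j) \<and> x = (\<Sum>j=1..s. f j)) = restrict f {1..s}"
    using direct_sum[of x] by (intro the1_equality)
  then show ?thesis using assms(3) by (simp add: layer_component_def)
qed

lemma linear_layer_component: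
  assumes "k \<in> {1..s}"
  shows "linear (layer_component k)"
proof (rule linearI)
  fix x y
  show "layer_component k (x + y) = layer_component k x + layer_component k y"
  proof (rule layer_component_eqI[OF _ _ assms])
    show "x + y = (\<Sum>j=1..s. layer_component j x + layer_component j y)"
      by (simp only: sum.distrib sum_layer_component)
  qed (use layer_component_in subspace_layer in \<open>auto intro: subspace_add\<close>)
next
  fix a x
  show "layer_component k (a *\<^sub>R x) = a *\<^sub>R layer_component k x"
  proof (rule layer_component_eqI[OF _ _ assms])
    show "a *\<^sub>R x = (\<Sum>j=1..s. a *\<^sub>R layer_component j x)"
      by (simp only: sum_layer_component flip: scaleR_sum_right)
  qed (use layer_component_in subspace_layer in \<open>auto intro: subspace_scale\<close>)
qed

lemma layer_component_layer:
  assumes "j \<in> {1..s}" "k \<in> {1..s}" "x \<in> H j"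
  shows "layer_component k x = (if k = j then x else 0)"
  by (rule layer_component_eqI) (use assms subspace_layer in \<open>auto simp: subspace_0 sum.delta\<close>)

lemma subspace_layers: "subspace (layers H j k)"
  by (simp add: layers_def)

lemma layers_mono: "j' \<le> j \<Longrightarrow> layers H j s \<subseteq> layers H j' s"
  unfolding layers_def by (intro span_mono UN_mono) auto

lemma layer_subset_layers: "1 \<le> j \<Longrightarrow> j \<le> k \<Longrightarrow> H k \<subseteq> layers H j s"
proof (cases "k \<le> s")
  case True
  assume "1 \<le> j" "j \<le> k"
  then have "H k \<subseteq> (\<Union>i\<in>{j..s}. H i)" using True by (intro UN_upper) simp
  then show ?thesis unfolding layers_def using span_superset by blast
next
  case False
  then show ?thesis using layer_beyond[of k] subspace_layers by (simp add: subspace_0)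
qed

lemma mem_layers_iff:
  assumes "1 \<le> k"
  shows "x \<in> layers H k s \<longleftrightarrow> (\<forall>j\<in>{1..s}. j < k \<longrightarrow> layer_component j x = 0)"
proof
  assume x: "x \<in> layers H k s"
  show "\<forall>j\<in>{1..s}. j < k \<longrightarrow> layer_component j x = 0"
  proof (intro ballI impI)
    fix j assume j: "j \<in> {1..s}" "j < k"
    show "layer_component j x = 0"
    proof (rule linear_eq_0_on_span[OF linear_layer_component[OF j(1)]])
      show "x \<in> span (\<Union>i\<in>{k..s}. H i)" using x by (simp add: layers_def)
    next
      fix y assume "y \<in> (\<Union>i\<in>{k..s}. H i)"
      then obtain i where "i \<in> {k..s}" "y \<in> H i" by blast
      then show "layer_component j y = 0"
        using layer_component_layer[of i j y] j assms by auto
    qed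
  qed
next
  assume *: "\<forall>j\<in>{1..s}. j < k \<longrightarrow> layer_component j x = 0"
  have "layer_component j x \<in> layers H k s" if "j \<in> {1..s}" for j
    using * that layer_component_in[OF that] layer_subset_layers[OF assms, of j] subspace_0[OF subspace_layers]
    by (cases "j < k") auto
  then have "(\<Sum>j=1..s. layer_component j x) \<in> layers H k s"
    by (intro subspace_sum subspace_layers)
  then show "x \<in> layers H k s" by (simp only: sum_layer_component)
qed

text \<open>\<open>br x x = 0\<close> makes the bracket antisymmetric, which transfers
  \<open>bracket_layers\<close> to the left argument.\<close>

lemma bracket_layers_left:
  assumes "x \<in> layers H k s" "1 \<le> k"
  shows "br x y \<in> layers H (k + 1) s"
proof -
  have lin: "linear (br x)" "linear (\<lambda>x. br x y)" for x y
    using bilinear_bracket by (auto simp: bilinear_def)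
  have "br (x + y) (x + y) = br x x + br x y + (br y x + br y y)"
    by (simp add: linear_add[OF lin(1)] linear_add[OF lin(2)])
  then have "br x y = - br y x"
    by (simp add: bracket_self eq_neg_iff_add_eq_0)
  then show ?thesis
    using bracket_layers[OF assms, of y] subspace_neg[OF subspace_layers] by metis
qed

text \<open>Use \<open>[x, X] - [y, Y] = [x - y, X] + [y, X - Y]\<close>, where each bracket raises
  the layer. A word of length 1 contains no bracket and gains nothing, hence the case
  distinction.\<close>

lemma nested_bracket_diff_in_layers:
  assumes "1 \<le> m" "list_all2 (\<lambda>x y. x - y \<in> layers H m s) xs ys" "xs \<noteq> []"
  shows "nested_bracket br xs - nested_bracket br ys
    \<in> layers H (if length xs = 1 then m else m + 1) s"
  using assms(3,2)
proof (induction xs arbitrary: ys rule: list_nonempty_induct)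
  case (single x)
  then show ?case by (auto simp: list_all2_Cons1)
next
  case (cons x xs)
  then obtain y ys' where ys: "ys = y # ys'" "x - y \<in> layers H m s"
      "list_all2 (\<lambda>x y. x - y \<in> layers H m s) xs ys'"
    by (auto simp: list_all2_Cons1)
  obtain x' xs' where xs: "xs = x' # xs'" using cons(1) by (cases xs) auto
  obtain y' ys'' where ys': "ys' = y' # ys''" using ys(3) by (auto simp: xs list_all2_Cons1)
  let ?X = "nested_bracket br xs" and ?Y = "nested_bracket br ys'"
  have lin: "linear (br x)" "linear (\<lambda>x. br x y)" for x y
    using bilinear_bracket by (auto simp: bilinear_def)
  have "?X - ?Y \<in> layers H m s"
    using cons.IH[OF ys(3)] layers_mono[of m "if length xs = 1 then m else m + 1"]
    by (auto split: if_splits)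
  then have "br (x - y) ?X + br y (?X - ?Y) \<in> layers H (m + 1) s"
    using ys(2) assms(1)
    by (intro subspace_add subspace_layers bracket_layers_left bracket_layers) auto
  also have "br (x - y) ?X + br y (?X - ?Y) = br x ?X - br y ?Y"
    by (simp add: linear_diff[OF lin(1)] linear_diff[OF lin(2)])
  finally show ?case by (simp add: ys xs ys')
qed

text \<open>The innermost bracket is taken between two multiples of \<open>v\<close> and
  vanishes.\<close>

lemma nested_bracket_collinear:
  assumes "set xs \<subseteq> span {v}" "2 \<le> length xs"
  shows "nested_bracket br xs = 0"
  using assms
proof (induction xs rule: induct_list012)
  case (3 x y zs)
  have lin: "linear (br x)" for x
    using bilinear_bracket by (auto simp: bilinear_def)
  have lin2: "linear (\<lambda>x. br x y)" for y
    using bilinear_bracket by (auto simp: bilinear_def)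
  show ?case
  proof (cases zs)
    case Nil
    obtain a b where "x = a *\<^sub>R v" "y = b *\<^sub>R v"
      using 3(3) by (auto simp: span_singleton)
    then show ?thesis
      using Nil by (simp add: linear_scale[OF lin] linear_scale[OF lin2] bracket_self)
  next
    case Cons
    then have "nested_bracket br (y # zs) = 0" using 3 by simp
    then show ?thesis by (simp add: linear_0[OF lin])
  qed
qed auto

text \<open>A bilinear map in finite dimension is continuous; writing the word as a list of
  functions lets the induction follow \<open>nested_bracket\<close>.\<close>

lemma continuous_on_nested_bracket:
  assumes "\<And>f. f \<in> set fs \<Longrightarrow> continuous_on UNIV f"
  shows "continuous_on UNIV (\<lambda>x. nested_bracket br (map (\<lambda>f. f x) fs))"
  using assms
proof (induction fs rule: induct_list012)
  case (3 f g hs)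
  interpret bounded_bilinear br
    using bilinear_bracket by (simp add: bilinear_conv_bounded_bilinear)
  show ?case using 3 by (auto intro!: continuous_on)
qed auto

lemma continuous_on_bch: "continuous_on UNIV (bch br s v)"
proof -
  have "continuous_on UNIV (\<lambda>x. nested_bracket br (dynkin_word v x p))" for p
  proof -
    have "continuous_on UNIV (\<lambda>x. nested_bracket br (map (\<lambda>f. f x) (dynkin_word (\<lambda>_. v) (\<lambda>x. x) p)))"
      using set_dynkin_word[of "\<lambda>_. v" "\<lambda>x. x" p] by (intro continuous_on_nested_bracket) auto
    then show ?thesis by (simp add: map_dynkin_word)
  qed
  then show ?thesis unfolding bch_def by (intro continuous_intros)
qed

text \<open>The terms of degree at least 2 in Dynkin's series. With \<open>v = - u\<close> this is
  the map \<open>q\<close> of the outline above.\<close>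

definition bch_tail :: "'a \<Rightarrow> 'a \<Rightarrow> 'a" where
  "bch_tail v x =
     (\<Sum>k=1..s. ((-1) ^ (k - 1) / real k) *\<^sub>R
        (\<Sum>p\<in>{p \<in> dynkin_exponents s k. 2 \<le> dynkin_degree p}.
           (1 / (real (dynkin_degree p) * (\<Prod>(a, b)\<leftarrow>p. fact a * fact b))) *\<^sub>R
             nested_bracket br (dynkin_word v x p)))"

text \<open>In degree 1 only the exponent lists \<open>[(1, 0)]\<close> and \<open>[(0, 1)]\<close>
  occur, contributing \<open>v\<close> and \<open>x\<close>; lists of length at least 2 have degree
  at least 2 and belong to the tail.\<close>

lemma bch_eq_add_tail: "bch br s v x = v + x + bch_tail v x"
proof -
  define T where "T p = (1 / (real (dynkin_degree p) * (\<Prod>(a, b)\<leftarrow>p. fact a * fact b))) *\<^sub>R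
    nested_bracket br (dynkin_word v x p)" for p
  define E where "E k = {p \<in> dynkin_exponents s k. 2 \<le> dynkin_degree p}" for k
  define c :: "nat \<Rightarrow> real" where "c k = (-1) ^ (k - 1) / real k" for k
  have fin: "finite (E k)" for k by (simp add: E_def finite_dynkin_exponents)
  have "(\<Sum>p\<in>dynkin_exponents s k. T p) = (if k = 1 then v + x else 0) + (\<Sum>p\<in>E k. T p)"
    if k: "k \<in> {1..s}" for k
  proof (cases "k = 1")
    case True
    have "p = [(1, 0)] \<or> p = [(0, 1)] \<or> p \<in> E 1" if p: "p \<in> dynkin_exponents s 1" for p
    proof -
      have "length p = 1" using p by (simp add: dynkin_exponents_def)
      then obtain a b where p_eq: "p = [(a, b)]" by (auto simp: length_Suc_conv)
      then have "0 < a + b" using p by (simp add: dynkin_exponents_def)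
      then consider "2 \<le> a + b" | "a = 1 \<and> b = 0" | "a = 0 \<and> b = 1" by linarith
      then show ?thesis using p by cases (auto simp: p_eq E_def dynkin_degree_def)
    qed
    then have "dynkin_exponents s k = {[(1, 0)], [(0, 1)]} \<union> E 1"
      using step_pos True by (auto simp: E_def dynkin_exponents_def dynkin_degree_def)
    moreover have "{[(1, 0)], [(0, 1)]} \<inter> E 1 = {}"
      by (auto simp: E_def dynkin_degree_def)
    ultimately have "(\<Sum>p\<in>dynkin_exponents s k. T p) = (\<Sum>p\<in>{[(1, 0)], [(0, 1)]}. T p) + (\<Sum>p\<in>E 1. T p)"
      by (simp only: sum.union_disjoint fin finite.intros)
    then show ?thesis using True by (simp add: T_def dynkin_degree_def dynkin_word_def)
  next
    case False
    then have "dynkin_exponents s k = E k"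
      using k length_le_dynkin_degree unfolding E_def dynkin_exponents_def by fastforce
    then show ?thesis using False by simp
  qed
  then have "bch br s v x = (\<Sum>k=1..s. c k *\<^sub>R ((if k = 1 then v + x else 0) + (\<Sum>p\<in>E k. T p)))"
    unfolding bch_def T_def[symmetric] c_def[symmetric] by (intro sum.cong) auto
  also have "\<dots> = (\<Sum>k=1..s. if k = 1 then c k *\<^sub>R (v + x) else 0) + (\<Sum>k=1..s. c k *\<^sub>R (\<Sum>p\<in>E k. T p))"
    unfolding sum.distrib[symmetric] by (intro sum.cong) (auto simp: scaleR_right_distrib)
  also have "(\<Sum>k=1..s. if k = 1 then c k *\<^sub>R (v + x) else 0) = v + x"
    using step_pos by (simp add: sum.delta c_def)
  also have "(\<Sum>k=1..s. c k *\<^sub>R (\<Sum>p\<in>E k. T p)) = bch_tail v x"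
    by (simp add: bch_tail_def T_def c_def E_def)
  finally show ?thesis .
qed

lemma bch_tail_collinear:
  assumes "x \<in> span {v}"
  shows "bch_tail v x = 0"
proof -
  have "nested_bracket br (dynkin_word v x p) = 0" if "2 \<le> dynkin_degree p" for p
    using set_dynkin_word[of v x p] assms that
    by (intro nested_bracket_collinear[of _ v]) (auto simp: length_dynkin_word span_base)
  then show ?thesis by (simp add: bch_tail_def)
qed

lemma bch_uminus_left: "bch br s (- u) u = 0"
proof -
  have "u \<in> span {- u}" using span_neg[of "- u" "{- u}"] by (simp add: span_base)
  then show ?thesis by (simp add: bch_eq_add_tail bch_tail_collinear)
qed

text \<open>Every word of the tail contains a bracket, so a change of \<open>x\<close> in the layers
  from \<open>m\<close> on is felt only beyond layer \<open>m\<close>. This is the triangular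
  structure behind the shears.\<close>

lemma bch_tail_diff_in_layers:
  assumes "1 \<le> m" "x - y \<in> layers H m s"
  shows "bch_tail v x - bch_tail v y \<in> layers H (m + 1) s"
proof -
  have "nested_bracket br (dynkin_word v x p) - nested_bracket br (dynkin_word v y p) \<in> layers H (m + 1) s"
    if "2 \<le> dynkin_degree p" for p
  proof -
    have all2: "list_all2 (\<lambda>x y. x - y \<in> layers H m s) (dynkin_word v x p) (dynkin_word v y p)"
    proof -
      have "list_all2 (\<lambda>x y. x - y \<in> layers H m s) (replicate k a) (replicate k b)"
        if "a - b \<in> layers H m s" for k a b
        using that by (simp add: list_all2_conv_all_nth)
      then show ?thesis
        unfolding dynkin_word_def using assms(2)
        by (induction p) (auto simp: subspace_0[OF subspace_layers] intro!: list_all2_appendI)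
    qed
    have "dynkin_word v x p \<noteq> []" "length (dynkin_word v x p) \<noteq> 1"
      using that length_dynkin_word[of v x p] by auto
    then show ?thesis
      using nested_bracket_diff_in_layers[OF assms(1) all2] by simp
  qed
  then show ?thesis
    unfolding bch_tail_def sum_subtractf[symmetric] scaleR_diff_right[symmetric]
    by (intro subspace_sum subspace_scale subspace_layers) auto
qed

text \<open>Compare with the point 0, where the tail vanishes.\<close>

lemma bch_tail_in_layers:
  assumes "1 \<le> m" "x \<in> layers H m s"
  shows "bch_tail v x \<in> layers H (m + 1) s"
proof -
  have "bch_tail v 0 = 0" by (rule bch_tail_collinear) (simp add: span_zero)
  then show ?thesis using bch_tail_diff_in_layers[OF assms(1), of x 0 v] assms(2) by simp
qed

text \<open>On \<open>N\<close>, the map \<open>x \<mapsto> x + bch_tail v x\<close> is a composition of shears, one for each layer above \<open>l\<close>.\<close>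

lemma hausdorff_measure_bch_translate:
  assumes N: "subspace N" "dim N = n" "layers H (l + 1) s \<subseteq> N" "N \<subseteq> layers H l s" and l: "1 \<le> l"
  shows "hausdorff_measure n ({x. bch br s v x \<in> A} \<inter> N) = hausdorff_measure n ({x. v + x \<in> A} \<inter> N)"
proof -
  define g where "g k x = layer_component k (bch_tail v x)" for k x
  have tail_meas: "bch_tail v \<in> borel_measurable borel"
  proof -
    have "bch_tail v = (\<lambda>x. bch br s v x - (v + x))" by (simp add: bch_eq_add_tail fun_eq_iff)
    moreover have "continuous_on UNIV (\<lambda>x. bch br s v x - (v + x))"
      by (intro continuous_intros continuous_on_bch)
    ultimately show ?thesis by (simp add: borel_measurable_continuous_onI)
  qed
  have g_meas: "g k \<in> borel_measurable borel" if "k \<in> {1..s}" for k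
  proof -
    have "layer_component k \<in> borel_measurable borel"
      using linear_layer_component[OF that]
      by (intro borel_measurable_continuous_onI linear_continuous_on) (simp add: linear_conv_bounded_linear)
    then show ?thesis using measurable_compose[OF tail_meas] by (simp add: g_def[abs_def])
  qed
  have g_H: "g k x \<in> H k" if "k \<in> {1..s}" for k x
    using layer_component_in[OF that] by (simp add: g_def)
  \<comment> \<open>The case \<open>j = k\<close> is the invariance required of a shear; the cases
    \<open>j < k\<close> allow the shears to be composed.\<close>
  have g_shift: "g j (x + y) = g j x" if "j \<le> k" "j \<in> {1..s}" "k \<in> {1..s}" "y \<in> H k" for j k x y
  proof -
    have "y \<in> layers H k s" using layer_subset_layers[of k k] that by auto
    then have "bch_tail v (x + y) - bch_tail v x \<in> layers H (k + 1) s"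
      using that by (intro bch_tail_diff_in_layers) auto
    then have "layer_component j (bch_tail v (x + y) - bch_tail v x) = 0"
      using mem_layers_iff[of "k + 1"] that by auto
    then show ?thesis by (simp add: g_def linear_diff[OF linear_layer_component[OF that(2)]])
  qed
  have shears: "hausdorff_measure n ({x. x + (\<Sum>k=1..m. g k x) \<in> A} \<inter> N) = hausdorff_measure n (A \<inter> N)"
    if "m \<le> s" for m A
    using that
  proof (induction m)
    case (Suc m)
    let ?k = "Suc m"
    have k: "?k \<in> {1..s}" using Suc by simp
    show ?case
    proof (cases "l < ?k")
      case True
      \<comment> \<open>The shear in layer \<open>?k\<close> leaves the lower components of the tail
        unchanged, so it can be applied first.\<close>
      have comp: "x + (\<Sum>j=1..?k. g j x) = (x + g ?k x) + (\<Sum>j=1..m. g j (x + g ?k x))" for x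
      proof -
        have "(\<Sum>j=1..m. g j (x + g ?k x)) = (\<Sum>j=1..m. g j x)"
          using k by (intro sum.cong g_shift[of _ ?k] g_H) auto
        then show ?thesis by simp
      qed
      have "H ?k \<subseteq> N" using layer_subset_layers[of "l + 1" ?k] N(3) True l by auto
      have "{x. x + (\<Sum>j=1..?k. g j x) \<in> A} = {x. x + g ?k x \<in> {y. y + (\<Sum>j=1..m. g j y) \<in> A}}"
        by (simp only: comp mem_Collect_eq)
      also have "hausdorff_measure n (\<dots> \<inter> N) = hausdorff_measure n ({y. y + (\<Sum>j=1..m. g j y) \<in> A} \<inter> N)"
      proof (rule hausdorff_measure_shear[OF N(1,2) linear_layer_component[OF k]])
        show "layer_component ?k x \<in> N" for x
          using layer_component_in[OF k] \<open>H ?k \<subseteq> N\<close> by blast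
        show "g ?k \<in> borel_measurable borel" by (rule g_meas[OF k])
        show "layer_component ?k (g ?k x) = g ?k x" for x
          using layer_component_layer[OF k k g_H[OF k]] by simp
        show "g ?k (x + layer_component ?k z) = g ?k x" for x z
          using g_shift[OF order_refl k k layer_component_in[OF k]] .
      qed
      also have "\<dots> = hausdorff_measure n (A \<inter> N)" using Suc by simp
      finally show ?thesis .
    next
      case False
      \<comment> \<open>On \<open>N \<subseteq> layers H l s\<close> the tail lies in the layers
        above \<open>l\<close>, so its components up to \<open>l\<close> contribute nothing.\<close>
      have "g ?k x = 0" if "x \<in> N" for x
      proof -
        have "bch_tail v x \<in> layers H (l + 1) s" using that N(4) l by (intro bch_tail_in_layers) auto
        then show ?thesis using mem_layers_iff[of "l + 1"] k False by (simp add: g_def)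
      qed
      then have "{x. x + (\<Sum>j=1..?k. g j x) \<in> A} \<inter> N = {x. x + (\<Sum>j=1..m. g j x) \<in> A} \<inter> N"
        by auto
      then show ?thesis using Suc by simp
    qed
  qed simp
  have "bch br s v x = v + (x + (\<Sum>k=1..s. g k x))" for x
    by (simp only: bch_eq_add_tail g_def sum_layer_component add.assoc)
  then show ?thesis
    using shears[of s "{x. v + x \<in> A}"] by simp
qed

text \<open>Left invariance gives \<open>d u x = d 0 (bch br s (- u) x)\<close>, and replacing this
  product by \<open>x - u\<close> does not change the measure. What remains involves only vector
  translates of the unit ball, to which linear isometries apply.\<close>

lemma spherical_factor_eq:
  assumes N: "subspace N" "dim N = n" "layers H (l + 1) s \<subseteq> N" "N \<subseteq> layers H l s" and l: "1 \<le> l"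
    and d: "homogeneous_distance br s H d"
  shows "spherical_factor d n N =
    (SUP u\<in>closed_ball d 0 1. hausdorff_measure n ({x. x - u \<in> closed_ball d 0 1} \<inter> N))"
proof -
  interpret Metric_space UNIV d using d by (simp add: homogeneous_distance_def)
  have inv: "d (bch br s z x) (bch br s z y) = d x y" for x y z
    using d by (simp add: homogeneous_distance_def)
  have "d u x = d 0 (bch br s (- u) x)" for u x
    using inv[of "- u" u x] by (simp add: bch_uminus_left)
  then have ball: "closed_ball d u 1 = {x. bch br s (- u) x \<in> closed_ball d 0 1}" for u
    by (auto simp: in_mcball)
  have "hausdorff_measure n (closed_ball d u 1 \<inter> N) =
      hausdorff_measure n ({x. x - u \<in> closed_ball d 0 1} \<inter> N)" for u
    unfolding ball[of u]
    using hausdorff_measure_bch_translate[OF N l, of "- u" "closed_ball d 0 1"]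
    by (simp only: uminus_add_conv_diff)
  moreover have "{u. d u 0 \<le> 1} = closed_ball d 0 1"
    by (auto simp: in_mcball commute)
  ultimately show ?thesis by (simp add: spherical_factor_def)
qed

end

section \<open>Vertical subgroups of a given dimension\<close>

text \<open>\<open>T\<close> carries the translate of \<open>B\<close> by \<open>u\<close> to the
  translate by \<open>T u\<close> and preserves the Hausdorff measure, so \<open>u\<close> is
  matched with \<open>T u\<close>.\<close>

lemma hausdorff_measure_translates_le:
  fixes T :: "'a::euclidean_space \<Rightarrow> 'a"
  assumes T: "orthogonal_transformation T" and B: "T ` B = B" and N: "T ` N\<^sub>1 = N\<^sub>2"
  shows "(SUP u\<in>B. hausdorff_measure n ({x. x - u \<in> B} \<inter> N\<^sub>1))
    \<le> (SUP u\<in>B. hausdorff_measure n ({x. x - u \<in> B} \<inter> N\<^sub>2))"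
proof (rule SUP_mono)
  fix u assume u: "u \<in> B"
  have lin: "linear T" and bij: "bij T"
    using T by (simp_all add: orthogonal_transformation_linear orthogonal_transformation_bij)
  have "dist (T x) (T y) = dist x y" for x y
    using T by (simp add: dist_norm orthogonal_transformation flip: linear_diff[OF lin])
  then have "hausdorff_measure n ({x. x - u \<in> B} \<inter> N\<^sub>1) = hausdorff_measure n (T ` ({x. x - u \<in> B} \<inter> N\<^sub>1))"
    using hausdorff_measure_isometry[OF _ bij] by simp
  also have "T ` ({x. x - u \<in> B} \<inter> N\<^sub>1) = {x. x - T u \<in> B} \<inter> N\<^sub>2"
  proof -
    have "T x - T u \<in> B \<longleftrightarrow> x - u \<in> B" for x
      using B inj_image_mem_iff[OF bij_is_inj[OF bij], of "x - u" B] by (simp add: linear_diff[OF lin])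
    then have "T ` {x. x - u \<in> B} = {x. x - T u \<in> B}"
      using bij_is_surj[OF bij] by (force simp: image_def surj_def)
    then show ?thesis using N image_Int[OF bij_is_inj[OF bij]] by metis
  qed
  finally show "\<exists>u'\<in>B. hausdorff_measure n ({x. x - u \<in> B} \<inter> N\<^sub>1)
      \<le> hausdorff_measure n ({x. x - u' \<in> B} \<inter> N\<^sub>2)"
    using u B by (intro bexI[of _ "T u"]) auto
qed

section \<open>Dimension counts and comparison of two vertical subgroups\<close>

context homogeneous_group
begin

lemma layers_split:
  assumes "l \<in> {1..s}"
  shows "layers H l s = {x + y | x y. x \<in> H l \<and> y \<in> layers H (l + 1) s}"
proof
  show "layers H l s \<subseteq> {x + y | x y. x \<in> H l \<and> y \<in> layers H (l + 1) s}"
  proof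
    fix x assume x: "x \<in> layers H l s"
    let ?c = "layer_component l x"
    have c: "?c \<in> H l" by (rule layer_component_in[OF assms])
    have "layer_component j (x - ?c) = 0" if "j \<in> {1..s}" "j < l + 1" for j
      using x mem_layers_iff[of l x] layer_component_layer[OF assms that(1) c] assms that
      by (auto simp: linear_diff[OF linear_layer_component])
    then have "x - ?c \<in> layers H (l + 1) s" using mem_layers_iff[of "l + 1"] by auto
    then show "x \<in> {x + y | x y. x \<in> H l \<and> y \<in> layers H (l + 1) s}"
      using c by (intro CollectI exI[of _ ?c] exI[of _ "x - ?c"]) simp
  qed
  show "{x + y | x y. x \<in> H l \<and> y \<in> layers H (l + 1) s} \<subseteq> layers H l s"
    using layer_subset_layers[of l l] layers_mono[of l "l + 1"] assms
    by (auto intro!: subspace_add[OF subspace_layers])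
qed

lemma dim_vertical:
  assumes "l \<in> {1..s}" "subspace S" "S \<subseteq> H l"
  shows "dim {x + y | x y. x \<in> S \<and> y \<in> layers H (l + 1) s} = dim S + dim (layers H (l + 1) s)"
proof -
  have "x = 0" if "x \<in> S" "x \<in> layers H (l + 1) s" for x
    using that assms mem_layers_iff[of "l + 1" x] layer_component_layer[OF assms(1) assms(1), of x] by auto
  then have "S \<inter> layers H (l + 1) s \<subseteq> {0}" by auto
  then have "dim (S \<inter> layers H (l + 1) s) = 0" by simp
  then show ?thesis using dim_sums_Int[OF assms(2) subspace_layers[of "l + 1" s]] by linarith
qed

lemma dim_layers:
  assumes "1 \<le> k" "k \<le> s + 1"
  shows "dim (layers H k s) = (\<Sum>j=k..s. dim (H j))"
  using assms(2)
proof (induction k rule: inc_induct)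
  case base
  then show ?case by (simp add: layers_def)
next
  case (step m)
  then have m: "m \<in> {1..s}" using assms by simp
  then have "dim (layers H m s) = dim (H m) + dim (layers H (m + 1) s)"
    using layers_split[OF m] dim_vertical[OF m subspace_layer order_refl] by simp
  also have "\<dots> = (\<Sum>j=m..s. dim (H j))"
    using step m by (simp add: sum.atLeast_Suc_atMost)
  finally show ?case .
qed

text \<open>The two inclusions between consecutive \<open>layers\<close> are what later allows
  \<open>N\<close> to be located by its dimension.\<close>

lemma vertical_subgroupE:
  assumes "vertical_subgroup br s H N"
  obtains l S where "l \<in> {1..s}" "subspace S" "S \<subseteq> H l"
    "N = {x + y | x y. x \<in> S \<and> y \<in> layers H (l + 1) s}"
    "subspace N" "layers H (l + 1) s \<subseteq> N" "N \<subseteq> layers H l s"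
    "dim N = dim S + dim (layers H (l + 1) s)"
proof -
  obtain l S where l: "l \<in> {1..s}" "subspace S" "S \<subseteq> H l"
    "N = {x + y | x y. x \<in> S \<and> y \<in> layers H (l + 1) s}"
    using assms unfolding vertical_subgroup_def by blast
  have "subspace N" unfolding l(4) by (intro subspace_sums l(2) subspace_layers)
  moreover have "layers H (l + 1) s \<subseteq> N"
    using subspace_0[OF l(2)] unfolding l(4) by (force intro: add_0)
  moreover have "N \<subseteq> layers H l s" unfolding layers_split[OF l(1)] l(4) using l(3) by blast
  ultimately show thesis using that l dim_vertical[OF l(1-3)] by blast
qed

lemma vertical_index:
  assumes "1 \<le> n" "n \<le> DIM('a)" "l = vertical_index s H n"
  shows "l \<in> {1..s}" "dim (layers H (l + 1) s) < n" "n \<le> dim (layers H l s)"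
proof -
  have "(\<Sum>j=1..s. dim (H j)) = DIM('a)"
    using dim_layers[of 1] span_layers by simp
  then have l: "l \<in> {1..s} \<and> (\<Sum>j=l+1..s. dim (H j)) < n \<and> n \<le> (\<Sum>j=l..s. dim (H j))"
    using theI'[OF ex1_vertical_index[of n H s]] assms by (simp add: vertical_index_def)
  then show "l \<in> {1..s}" "dim (layers H (l + 1) s) < n" "n \<le> dim (layers H l s)"
    using dim_layers[of l] dim_layers[of "l + 1"] by auto
qed

text \<open>\<open>J\<close> is extended by the identity on the other layers. As these are
  orthogonal to \<open>H l\<close>, Pythagoras shows that the norm is preserved.\<close>

lemma extend_layer_isometry:
  assumes orth: "orthogonal_layers s H" and l: "l \<in> {1..s}" and J: "J \<in> linear_isometries (H l)"
  obtains T where "orthogonal_transformation T" "\<And>x. x \<in> H l \<Longrightarrow> T x = J x"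
    "\<And>j x. j \<in> {1..s} \<Longrightarrow> j \<noteq> l \<Longrightarrow> x \<in> H j \<Longrightarrow> T x = x"
proof -
  define c where "c = layer_component l"
  have c: "c x \<in> H l" for x unfolding c_def by (rule layer_component_in[OF l])
  have lin_c: "linear c" unfolding c_def by (rule linear_layer_component[OF l])
  have J_H: "J x \<in> H l" and J_norm: "norm (J x) = norm x" if "x \<in> H l" for x
    using J that by (auto simp: linear_isometries_def)
  have J_lin: "J (a *\<^sub>R x + b *\<^sub>R y) = a *\<^sub>R J x + b *\<^sub>R J y" if "x \<in> H l" "y \<in> H l" for a b x y
    using J that by (auto simp: linear_isometries_def)
  have J_add: "J (x + y) = J x + J y" if "x \<in> H l" "y \<in> H l" for x y
    using J_lin[OF that, of 1 1] by simp
  have J_scale: "J (a *\<^sub>R x) = a *\<^sub>R J x" if "x \<in> H l" for a x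
    using J_lin[OF that that, of a 0] by simp
  define T where "T x = (x - c x) + J (c x)" for x
  have rest: "orthogonal (x - c x) h" if h: "h \<in> H l" for x h
  proof -
    have "h \<bullet> x = (\<Sum>k=1..s. h \<bullet> layer_component k x)"
      by (simp only: inner_sum_right[symmetric] sum_layer_component)
    also have "\<dots> = (\<Sum>k=1..s. if k = l then h \<bullet> c x else 0)"
    proof (rule sum.cong[OF refl])
      fix k assume k: "k \<in> {1..s}"
      show "h \<bullet> layer_component k x = (if k = l then h \<bullet> c x else 0)"
        using orth h l k layer_component_in[OF k]
        unfolding orthogonal_layers_def orthogonal_def c_def by auto
    qed
    also have "\<dots> = h \<bullet> c x" using l by simp
    finally show ?thesis by (simp add: orthogonal_def inner_diff_right inner_commute[of _ h])
  qed
  have "linear T"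
    by (rule linearI)
      (simp_all add: T_def linear_add[OF lin_c] linear_scale[OF lin_c] J_add J_scale c algebra_simps)
  moreover have "norm (T x) = norm x" for x
  proof -
    have "(norm (T x))\<^sup>2 = (norm (x - c x))\<^sup>2 + (norm (J (c x)))\<^sup>2"
      unfolding T_def by (intro norm_add_Pythagorean rest J_H c)
    also have "\<dots> = (norm ((x - c x) + c x))\<^sup>2"
      using norm_add_Pythagorean[OF rest[OF c[of x], of x]] by (simp add: J_norm c)
    finally show ?thesis by simp
  qed
  ultimately have "orthogonal_transformation T" by (simp add: orthogonal_transformation)
  moreover have "T x = J x" if "x \<in> H l" for x
    using layer_component_layer[OF l l that] by (simp add: T_def c_def)
  moreover have "T x = x" if "j \<in> {1..s}" "j \<noteq> l" "x \<in> H j" for j x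
  proof -
    have "c x = 0" using layer_component_layer[OF that(1) l that(3)] that(2) by (simp add: c_def)
    moreover have "J 0 = 0" using J_norm[of 0] subspace_0[OF subspace_layer] l by simp
    ultimately show ?thesis by (simp add: T_def)
  qed
  ultimately show thesis by (rule that)
qed

text \<open>An inequality suffices, as the roles of \<open>N\<^sub>1\<close> and
  \<open>N\<^sub>2\<close> can be exchanged.\<close>

lemma spherical_factor_le:
  assumes orth: "orthogonal_layers s H" and n: "1 \<le> n" "n \<le> DIM('a)"
    and d: "homogeneous_distance br s H d" and sym: "vertically_symmetric br s H n d"
    and N\<^sub>1: "vertical_subgroup br s H N\<^sub>1" "dim N\<^sub>1 = n"
    and N\<^sub>2: "vertical_subgroup br s H N\<^sub>2" "dim N\<^sub>2 = n"
  shows "spherical_factor d n N\<^sub>1 \<le> spherical_factor d n N\<^sub>2"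
proof -
  define l where "l = vertical_index s H n"
  define r where "r = vertical_rest s H n"
  define B where "B = closed_ball d 0 1"
  note l = vertical_index[OF n l_def]
  have dim_l: "dim (layers H l s) = dim (H l) + dim (layers H (l + 1) s)"
    using layers_split[OF l(1)] dim_vertical[OF l(1) subspace_layer order_refl] l(1) by simp
  have r: "r = n - dim (layers H (l + 1) s)"
    using dim_layers[of "l + 1"] l(1) by (simp add: r_def vertical_rest_def flip: l_def)
  show ?thesis
  proof (cases "r < dim (H l)")
    case True
    \<comment> \<open>Here the dimension forces \<open>l' = l\<close>: for \<open>l' < l\<close>,
      \<open>N\<close> would contain \<open>layers H l s\<close>, of dimension greater than
      \<open>n\<close>; for \<open>l' > l\<close> it would lie in \<open>layers H (l + 1) s\<close>,
      of dimension less than \<open>n\<close>.\<close>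
    have data: "\<exists>S. subspace S \<and> S \<subseteq> H l \<and> dim S = r \<and>
        N = {x + y | x y. x \<in> S \<and> y \<in> layers H (l + 1) s} \<and> subspace N \<and>
        layers H (l + 1) s \<subseteq> N \<and> N \<subseteq> layers H l s"
      if N: "vertical_subgroup br s H N" "dim N = n" for N
    proof -
      from N(1) obtain l' S where S: "l' \<in> {1..s}" "subspace S" "S \<subseteq> H l'"
        "N = {x + y | x y. x \<in> S \<and> y \<in> layers H (l' + 1) s}"
        "subspace N" "layers H (l' + 1) s \<subseteq> N" "N \<subseteq> layers H l' s"
        "dim N = dim S + dim (layers H (l' + 1) s)"
        by (rule vertical_subgroupE)
      have "\<not> l' < l"
      proof
        assume "l' < l"
        then have "dim (layers H l s) \<le> dim N"
          using S(6) layers_mono[of "l' + 1" l] by (intro dim_subset) auto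
        then show False using True N(2) r dim_l l(2) by linarith
      qed
      moreover have "\<not> l < l'"
      proof
        assume "l < l'"
        then have "dim N \<le> dim (layers H (l + 1) s)"
          using S(7) layers_mono[of "l + 1" l'] by (intro dim_subset) auto
        then show False using N(2) l(2) by simp
      qed
      ultimately have "l' = l" by simp
      then show ?thesis using S N(2) r by auto
    qed
    obtain S\<^sub>1 where S\<^sub>1: "subspace S\<^sub>1" "S\<^sub>1 \<subseteq> H l" "dim S\<^sub>1 = r"
        "N\<^sub>1 = {x + y | x y. x \<in> S\<^sub>1 \<and> y \<in> layers H (l + 1) s}"
        "subspace N\<^sub>1" "layers H (l + 1) s \<subseteq> N\<^sub>1" "N\<^sub>1 \<subseteq> layers H l s"
      using data[OF N\<^sub>1] by blast
    obtain S\<^sub>2 where S\<^sub>2: "subspace S\<^sub>2" "S\<^sub>2 \<subseteq> H l" "dim S\<^sub>2 = r"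
        "N\<^sub>2 = {x + y | x y. x \<in> S\<^sub>2 \<and> y \<in> layers H (l + 1) s}"
        "subspace N\<^sub>2" "layers H (l + 1) s \<subseteq> N\<^sub>2" "N\<^sub>2 \<subseteq> layers H l s"
      using data[OF N\<^sub>2] by blast
    have "r < dim (H l) \<longrightarrow> (\<exists>F\<subseteq>linear_isometries (H l).
        (\<forall>S\<^sub>1 S\<^sub>2. subspace S\<^sub>1 \<and> S\<^sub>1 \<subseteq> H l \<and> dim S\<^sub>1 = r \<and> subspace S\<^sub>2 \<and> S\<^sub>2 \<subseteq> H l \<and> dim S\<^sub>2 = r
          \<longrightarrow> (\<exists>J\<in>F. J ` S\<^sub>1 = S\<^sub>2)) \<and>
        (\<forall>T. orthogonal_transformation T \<and> (\<forall>j\<in>{1..s}. j \<noteq> l \<longrightarrow> (\<forall>x\<in>H j. T x = x)) \<and>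
          restrict T (H l) \<in> F \<longrightarrow> T ` B = B))"
      using sym unfolding vertically_symmetric_def Let_def l_def[symmetric] r_def[symmetric] B_def[symmetric]
      by (elim conjE ex_forward imp_forward) (assumption | rule conjI)+
    then obtain F where F: "F \<subseteq> linear_isometries (H l)"
        "\<And>S\<^sub>1 S\<^sub>2. subspace S\<^sub>1 \<Longrightarrow> S\<^sub>1 \<subseteq> H l \<Longrightarrow> dim S\<^sub>1 = r \<Longrightarrow> subspace S\<^sub>2 \<Longrightarrow> S\<^sub>2 \<subseteq> H l \<Longrightarrow>
          dim S\<^sub>2 = r \<Longrightarrow> \<exists>J\<in>F. J ` S\<^sub>1 = S\<^sub>2"
        "\<And>T. orthogonal_transformation T \<Longrightarrow> (\<forall>j\<in>{1..s}. j \<noteq> l \<longrightarrow> (\<forall>x\<in>H j. T x = x)) \<Longrightarrow>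
          restrict T (H l) \<in> F \<Longrightarrow> T ` B = B"
      using True by auto
    obtain J where J: "J \<in> F" "J ` S\<^sub>1 = S\<^sub>2"
      using F(2)[OF S\<^sub>1(1-3) S\<^sub>2(1-3)] by blast
    then have J_iso: "J \<in> linear_isometries (H l)" using F(1) by blast
    obtain T where T: "orthogonal_transformation T" "\<And>x. x \<in> H l \<Longrightarrow> T x = J x"
        "\<And>j x. j \<in> {1..s} \<Longrightarrow> j \<noteq> l \<Longrightarrow> x \<in> H j \<Longrightarrow> T x = x"
      using extend_layer_isometry[OF orth l(1) J_iso] by blast
    \<comment> \<open>The functions also agree off \<open>H l\<close>, where both are
      \<open>undefined\<close>, since the elements of \<open>linear_isometries\<close> are
      extensional.\<close>
    have "restrict T (H l) = J"
    proof
      fix x show "restrict T (H l) x = J x"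
        using T(2) J_iso by (cases "x \<in> H l") (auto simp: linear_isometries_def PiE_def extensional_def)
    qed
    then have TB: "T ` B = B" using F(3)[OF T(1)] T(3) J(1) by blast
    have T_id: "T x = x" if "x \<in> layers H (l + 1) s" for x
    proof (rule linear_eq_on[OF orthogonal_transformation_linear[OF T(1)] linear_id, unfolded id_apply])
      show "x \<in> span (\<Union>i\<in>{l + 1..s}. H i)" using that by (simp add: layers_def)
    next
      fix y assume "y \<in> (\<Union>i\<in>{l + 1..s}. H i)"
      then obtain i where "i \<in> {l + 1..s}" "y \<in> H i" by blast
      then show "T y = y" using T(3)[of i y] by simp
    qed
    have TS: "T ` S\<^sub>1 = S\<^sub>2" using T(2) S\<^sub>1(2) J(2) by (metis image_cong subsetD)
    have T_add: "T (x + y) = T x + T y" for x y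
      using orthogonal_transformation_linear[OF T(1)] by (rule linear_add)
    have TN: "T ` N\<^sub>1 = N\<^sub>2"
    proof
      show "T ` N\<^sub>1 \<subseteq> N\<^sub>2" 
      proof clarify
        fix z assume "z \<in> N\<^sub>1"
        then obtain x y where z: "z = x + y" "x \<in> S\<^sub>1" "y \<in> layers H (l + 1) s"
          unfolding S\<^sub>1(4) by blast
        then have "T z = T x + y" using T_id by (simp add: T_add)
        then show "T z \<in> N\<^sub>2" unfolding S\<^sub>2(4) TS[symmetric] using z by blast
      qed
      show "N\<^sub>2 \<subseteq> T ` N\<^sub>1"
      proof
        fix z assume "z \<in> N\<^sub>2"
        then obtain x y where "z = T x + y" "x \<in> S\<^sub>1" "y \<in> layers H (l + 1) s"
          unfolding S\<^sub>2(4) TS[symmetric] by blast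
        then have "z = T (x + y)" "x + y \<in> N\<^sub>1" using T_id by (auto simp: T_add S\<^sub>1(4))
        then show "z \<in> T ` N\<^sub>1" by blast
      qed
    qed
    have l1: "1 \<le> l" using l(1) by simp
    show ?thesis
      unfolding spherical_factor_eq[OF S\<^sub>1(5) N\<^sub>1(2) S\<^sub>1(6,7) l1 d]
        spherical_factor_eq[OF S\<^sub>2(5) N\<^sub>2(2) S\<^sub>2(6,7) l1 d] B_def[symmetric]
      by (rule hausdorff_measure_translates_le[OF T(1) TB TN])
  next
    case False
    then have n_eq: "dim (layers H l s) = n" using l(2,3) dim_l r False by linarith
    \<comment> \<open>Now \<open>l'\<close> may differ from \<open>l\<close>: for
      \<open>l > 1\<close>, \<open>layers H l s\<close> can also be written with
      \<open>l' = l - 1\<close> and \<open>S = {0}\<close>. In every case \<open>N\<close> and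
      \<open>layers H l s\<close> are comparable and of equal dimension.\<close>
    have uniq: "N = layers H l s" if N: "vertical_subgroup br s H N" "dim N = n" for N
    proof -
      from N(1) obtain l' S where S: "l' \<in> {1..s}" "subspace S" "S \<subseteq> H l'"
        "N = {x + y | x y. x \<in> S \<and> y \<in> layers H (l' + 1) s}"
        "subspace N" "layers H (l' + 1) s \<subseteq> N" "N \<subseteq> layers H l' s"
        "dim N = dim S + dim (layers H (l' + 1) s)"
        by (rule vertical_subgroupE)
      show ?thesis
      proof (cases "l \<le> l'")
        case True
        then have "N \<subseteq> layers H l s" using S(7) layers_mono by blast
        then show ?thesis using subspace_dim_equal[OF S(5) subspace_layers] N(2) n_eq by simp
      next
        case False
        then have "layers H l s \<subseteq> N" using S(6) layers_mono[of "l' + 1" l] by auto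
        then show ?thesis using subspace_dim_equal[OF subspace_layers S(5), of l s] N(2) n_eq by simp
      qed
    qed
    show ?thesis by (simp add: uniq[OF N\<^sub>1] uniq[OF N\<^sub>2])
  qed
qed

end

theorem theorem10p4:
  fixes br :: "'a::euclidean_space \<Rightarrow> 'a \<Rightarrow> 'a"
    and s n :: nat
    and H :: "nat \<Rightarrow> 'a set"
    and d :: "'a \<Rightarrow> 'a \<Rightarrow> real"
  assumes "homogeneous_group br s H"
    and "orthogonal_layers s H"
    and "1 \<le> n" and "n \<le> DIM('a)"
    and "homogeneous_distance br s H d"
    and "vertically_symmetric br s H n d"
  shows "\<exists>\<beta>. \<forall>N. vertical_subgroup br s H N \<and> dim N = n \<longrightarrow> spherical_factor d n N = \<beta>"
proof -
  interpret homogeneous_group br s H by fact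
  have "spherical_factor d n N\<^sub>1 = spherical_factor d n N\<^sub>2"
    if "vertical_subgroup br s H N\<^sub>1 \<and> dim N\<^sub>1 = n" "vertical_subgroup br s H N\<^sub>2 \<and> dim N\<^sub>2 = n" for N\<^sub>1 N\<^sub>2
    using spherical_factor_le[OF assms(2-6)] that by (intro antisym) auto
  then show ?thesis by metis
qed

end
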